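(* Let $\epsilon>0$. Suppose there is a data structure for path-tree LCE queries $\mathrm{LCE}_{PT}$ on edge-labeled rooted trees with $m$ nodes that uses $s(m)=\Omega(m)$ space and answers queries in $q(m)=\Omega(1)$ time. Then for any set $S\subseteq[0,U)$ of $n$ integers one can build a predecessor data structure for $S$ using $O(s(2U^{\epsilon}+n\log|U|))$ space and answering predecessor queries in $O(q(2U^{\epsilon}+n\log|U|))$ time.
   Context: A predecessor query for $x$ returns the largest $y\le x$ with $y\in S$. For a node $v$ and a descendant $w$ of $v$, $v\leadsto w$ is the downward path with string the concatenation of its edge labels (one character per edge) from top to bottom. The path-path LCE of two downward paths is their longest pair of path prefixes with equal strings. $\mathrm{LCE}_{PT}(v_1,w_1,v_2)$, for $w_1$ a descendant of $v_1$, returns the maximal path-path LCE of $v_1\leadsto w_1$ and any path from $v_2$ to a descendant leaf of $v_2$. The model is the word RAM with logarithmic word size. *)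

theory Defs
  imports
    Complex_Main
    "HOL-Library.Sublist"
    "HOL-Library.Landau_Symbols"
begin

section \<open>The word RAM\<close>

text \<open>
  A program is a fixed finite list of instructions with absolute jump targets. It works on
  registers (only those named in the program can matter, so constantly many) and on a memory of
  words that is addressed indirectly through registers. With word size \<open>w\<close>, words are the natural
  numbers below \<open>2 ^ w\<close>, and every instruction takes unit time. The program itself does not
  depend on \<open>w\<close>.
\<close>

datatype binop = Add | Sub | Mul | Div | Mod | And | Or | Xor | Shl | Shr | Less

datatype instr =
    Const nat nat         \<comment> \<open>target register, constant\<close>
  | Op binop nat nat nat  \<comment> \<open>target register, operand registers\<close>
  | Load nat nat          \<comment> \<open>target register, address register\<close>
  | Store nat nat         \<comment> \<open>address register, source register\<close>
  | Jz nat nat            \<comment> \<open>tested register, jump target taken if it is zero\<close>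
  | Halt

type_synonym program = "instr list"
type_synonym registers = "nat \<Rightarrow> nat"
type_synonym memory = "nat list"
type_synonym config = "nat \<times> registers \<times> memory"

fun binop_sem :: "nat \<Rightarrow> binop \<Rightarrow> nat \<Rightarrow> nat \<Rightarrow> nat" where
  "binop_sem w Add a b = (a + b) mod 2 ^ w"
| "binop_sem w Sub a b = (a + 2 ^ w - b) mod 2 ^ w"
| "binop_sem w Mul a b = (a * b) mod 2 ^ w"
| "binop_sem w Div a b = a div b"
| "binop_sem w Mod a b = a mod b"
| "binop_sem w And a b = Bit_Operations.and a b"
| "binop_sem w Or a b = Bit_Operations.or a b"
| "binop_sem w Xor a b = Bit_Operations.xor a b"
| "binop_sem w Shl a b = (a * 2 ^ b) mod 2 ^ w"
| "binop_sem w Shr a b = a div 2 ^ b"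
| "binop_sem w Less a b = (if a < b then 1 else 0)"

text \<open>
  The length of the memory never changes, and an access outside of it gets stuck. Hence the length
  bounds all cells an execution touches, including its working space.
\<close>

fun step :: "nat \<Rightarrow> program \<Rightarrow> config \<Rightarrow> config option" where
  "step w p (pc, r, M) =
    (if pc < length p then
      (case p ! pc of
         Const d c \<Rightarrow> Some (Suc pc, r(d := c mod 2 ^ w), M)
       | Op f d a b \<Rightarrow> Some (Suc pc, r(d := binop_sem w f (r a) (r b)), M)
       | Load d a \<Rightarrow> if r a < length M then Some (Suc pc, r(d := M ! r a), M) else None
       | Store a x \<Rightarrow> if r a < length M then Some (Suc pc, r, M[r a := r x]) else None
       | Jz x l \<Rightarrow> Some (if r x = 0 then l else Suc pc, r, M)
       | Halt \<Rightarrow> None)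
     else None)"

definition halts_in :: "nat \<Rightarrow> program \<Rightarrow> nat \<Rightarrow> registers \<Rightarrow> memory \<Rightarrow> registers \<Rightarrow> memory \<Rightarrow> bool" where
  "halts_in w p t r M r' M' \<longleftrightarrow>
    (\<exists>pc. ((\<lambda>\<sigma> \<tau>. step w p \<sigma> = Some \<tau>) ^^ t) (0, r, M) (pc, r', M')
        \<and> pc < length p \<and> p ! pc = Halt)"

definition input_regs :: "nat list \<Rightarrow> registers" where
  "input_regs args = (\<lambda>i. if i < length args then args ! i else 0)"

text \<open>
  The program \<open>p\<close> answers every query in \<open>Q\<close> (a list of argument words) by an answer admitted by
  \<open>ans\<close>, which is left in registers 0 and 1, within \<open>time\<close> steps and using \<open>space\<close> memory words.
  Queries may write to memory. The nonempty set \<open>\<M>\<close> of admissible memory contents is closed under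
  executing queries, so that any sequence of queries is answered correctly.
\<close>

definition supports_queries ::
    "nat \<Rightarrow> program \<Rightarrow> nat list set \<Rightarrow> (nat list \<Rightarrow> nat \<times> nat \<Rightarrow> bool) \<Rightarrow> real \<Rightarrow> real \<Rightarrow> bool" where
  "supports_queries w p Q ans space time \<longleftrightarrow>
    (\<exists>\<M>. \<M> \<noteq> {} \<and>
      (\<forall>M\<in>\<M>. real (length M) \<le> space \<and> set M \<subseteq> {..<2 ^ w} \<and>
        (\<forall>args\<in>Q. \<exists>t r' M'. halts_in w p t (input_regs args) M r' M' \<and> real t \<le> time \<and>
                            M' \<in> \<M> \<and> ans args (r' 0, r' 1))))"

text \<open>
  Word size logarithmic in the size parameter \<open>N\<close>; the numbers \<open>0, \<dots>, N - 1\<close> always fit into a word.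
\<close>

definition logarithmic_word_size :: "(nat \<Rightarrow> nat) \<Rightarrow> bool" where
  "logarithmic_word_size W \<longleftrightarrow>
    (\<forall>N. N \<le> 2 ^ W N) \<and> (\<lambda>N. real (W N)) \<in> \<Theta>(\<lambda>N. log 2 (real N))"


section \<open>Path-tree LCE queries\<close>

text \<open>
  Rooted trees on the nodes \<open>0, \<dots>, m - 1\<close>, given by the root \<open>rt\<close> and the set of edges from parents to
  children. Siblings may be reached by edges with equal labels.
\<close>

definition rooted_tree :: "nat \<Rightarrow> nat \<Rightarrow> (nat \<times> nat) set \<Rightarrow> bool" where
  "rooted_tree m rt E \<longleftrightarrow>
    rt < m \<and> E \<subseteq> {..<m} \<times> {..<m} \<and>
    (\<forall>u. (u, rt) \<notin> E) \<and>
    (\<forall>v<m. v \<noteq> rt \<longrightarrow> (\<exists>!u. (u, v) \<in> E)) \<and>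
    (\<forall>v<m. (rt, v) \<in> E\<^sup>*)"

definition leaf :: "(nat \<times> nat) set \<Rightarrow> nat \<Rightarrow> bool" where
  "leaf E v \<longleftrightarrow> (\<forall>u. (v, u) \<notin> E)"

definition down_path :: "(nat \<times> nat) set \<Rightarrow> nat \<Rightarrow> nat \<Rightarrow> nat list \<Rightarrow> bool" where
  "down_path E v w xs \<longleftrightarrow>
    xs \<noteq> [] \<and> hd xs = v \<and> last xs = w \<and> successively (\<lambda>x y. (x, y) \<in> E) xs"

definition path_string :: "(nat \<times> nat \<Rightarrow> nat) \<Rightarrow> nat list \<Rightarrow> nat list" where
  "path_string lab xs = map lab (zip xs (tl xs))"

definition equal_path_prefixes ::
    "(nat \<times> nat \<Rightarrow> nat) \<Rightarrow> nat list \<Rightarrow> nat list \<Rightarrow> nat list \<times> nat list \<Rightarrow> bool" where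
  "equal_path_prefixes lab xs ys = (\<lambda>(ps, qs).
    ps \<noteq> [] \<and> qs \<noteq> [] \<and> prefix ps xs \<and> prefix qs ys \<and> path_string lab ps = path_string lab qs)"

definition lce_path_path ::
    "(nat \<times> nat \<Rightarrow> nat) \<Rightarrow> nat list \<Rightarrow> nat list \<Rightarrow> nat list \<times> nat list \<Rightarrow> bool" where
  "lce_path_path lab xs ys z \<longleftrightarrow>
    equal_path_prefixes lab xs ys z \<and>
    (\<forall>z'. equal_path_prefixes lab xs ys z' \<longrightarrow> length (fst z') \<le> length (fst z))"

definition lce_candidate ::
    "(nat \<times> nat) set \<Rightarrow> (nat \<times> nat \<Rightarrow> nat) \<Rightarrow> nat \<Rightarrow> nat \<Rightarrow> nat \<Rightarrow> nat list \<times> nat list \<Rightarrow> bool" where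
  "lce_candidate E lab v1 w1 v2 z \<longleftrightarrow>
    (\<exists>xs ys l. down_path E v1 w1 xs \<and> leaf E l \<and> down_path E v2 l ys \<and> lce_path_path lab xs ys z)"

definition lce_path_tree ::
    "(nat \<times> nat) set \<Rightarrow> (nat \<times> nat \<Rightarrow> nat) \<Rightarrow> nat \<Rightarrow> nat \<Rightarrow> nat \<Rightarrow> nat list \<times> nat list \<Rightarrow> bool" where
  "lce_path_tree E lab v1 w1 v2 z \<longleftrightarrow>
    lce_candidate E lab v1 w1 v2 z \<and>
    (\<forall>z'. lce_candidate E lab v1 w1 v2 z' \<longrightarrow> length (fst z') \<le> length (fst z))"

text \<open>
  As the top nodes \<open>v1\<close> and \<open>v2\<close> are part of the query, the resulting pair of path prefixes is
  returned by its two bottom nodes. If the maximum is attained by several pairs, any of them is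
  a correct answer.
\<close>

definition lce_pt_answer ::
    "(nat \<times> nat) set \<Rightarrow> (nat \<times> nat \<Rightarrow> nat) \<Rightarrow> nat list \<Rightarrow> nat \<times> nat \<Rightarrow> bool" where
  "lce_pt_answer E lab args a \<longleftrightarrow>
    (\<exists>v1 w1 v2 ps qs. args = [v1, w1, v2] \<and> lce_path_tree E lab v1 w1 v2 (ps, qs) \<and>
                      a = (last ps, last qs))"

definition lce_pt_queries :: "nat \<Rightarrow> (nat \<times> nat) set \<Rightarrow> nat list set" where
  "lce_pt_queries m E = {[v1, w1, v2] | v1 w1 v2. v1 < m \<and> v2 < m \<and> (v1, w1) \<in> E\<^sup>*}"

text \<open>One program serves all trees. Edge labels are arbitrary characters that fit into a word.\<close>

definition lce_pt_structure :: "(nat \<Rightarrow> real) \<Rightarrow> (nat \<Rightarrow> real) \<Rightarrow> bool" where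
  "lce_pt_structure space time \<longleftrightarrow>
    (\<exists>W p. logarithmic_word_size W \<and>
      (\<forall>m rt E lab. rooted_tree m rt E \<and> (\<forall>e\<in>E. lab e < 2 ^ W m) \<longrightarrow>
        supports_queries (W m) p (lce_pt_queries m E) (lce_pt_answer E lab) (space m) (time m)))"


section \<open>Predecessor queries\<close>

text \<open>
  Register 0 tells whether a predecessor exists, and if it does, register 1 holds it.
\<close>

definition predecessor_answer :: "nat set \<Rightarrow> nat list \<Rightarrow> nat \<times> nat \<Rightarrow> bool" where
  "predecessor_answer S args a \<longleftrightarrow>
    (\<exists>x. args = [x] \<and>
      (if \<exists>y\<in>S. y \<le> x then a = (1, Max {y \<in> S. y \<le> x}) else fst a = 0))"

text \<open>Space and time are functions of the universe size \<open>U\<close> and the number \<open>n\<close> of keys.\<close>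

definition predecessor_structure :: "(nat \<Rightarrow> nat \<Rightarrow> real) \<Rightarrow> (nat \<Rightarrow> nat \<Rightarrow> real) \<Rightarrow> bool" where
  "predecessor_structure space time \<longleftrightarrow>
    (\<exists>W p. logarithmic_word_size W \<and>
      (\<forall>U S. S \<subseteq> {..<U} \<longrightarrow>
        supports_queries (W U) p {[x] | x. x < U} (predecessor_answer S)
          (space U (card S)) (time U (card S))))"

definition reduction_size :: "real \<Rightarrow> nat \<Rightarrow> nat \<Rightarrow> nat" where
  "reduction_size \<epsilon> U n = nat \<lceil>2 * real U powr \<epsilon> + real n * log 2 (real U)\<rceil>"

text \<open>\<open>U\<close> tends to infinity, uniformly in \<open>n\<close>.\<close>

definition large_universe :: "(nat \<times> nat) filter" where
  "large_universe = filtercomap fst at_top"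

end

theory Submission
  imports Defs "HOL-Real_Asymp.Real_Asymp"
begin

text \<open>
  Write the keys in base 4 and put them into a trie. Next to the trie, add a path for every block
  of \<open>c\<close> digits, where \<open>4 ^ c\<close> is about \<open>U powr (1 / k)\<close> for a constant \<open>k > 1 / \<epsilon>\<close>. To search for \<open>x\<close>, split
  it into \<open>k\<close> blocks; an LCE query between the path of the next block and the current trie node moves
  down as far as the trie agrees with \<open>x\<close>. After at most \<open>k\<close> queries this yields the node where \<open>x\<close> leaves
  the trie, and there the predecessor depends on the next digit only, so it can be tabulated. The
  word size of the given structure depends on the tree size and hence on the number of keys, so its
  program is simulated on a machine with a larger word size.
\<close>

section \<open>Executing and simulating programs\<close>

text \<open>An LCE query compares two paths that both lie in the tree, and a path spelling
  \<open>x\<close> cannot be stored for each of the \<open>U\<close> possible queries. Cutting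
  \<open>x\<close> into blocks leaves only about \<open>U powr (1 / k)\<close> different strings to
  store, and these paths fit into \<open>2 * U powr \<epsilon>\<close> nodes because
  \<open>1 / k < \<epsilon>\<close>; as \<open>k\<close> is constant, so is the number of LCE
  queries. Both bottom nodes of an answer are used: the one on the block path tells whether the
  whole block was matched, the one in the trie is where the search continues.

  The remaining difficulty is that the quantities depend on different parameters. Nothing is known
  about how \<open>s\<close> and \<open>q\<close> behave between different sizes, so for large
  \<open>U\<close> the tree must have exactly \<open>reduction_size\<close> nodes, uniformly in the
  number of keys. The word size of the predecessor machine, in contrast, may depend on
  \<open>U\<close> only.\<close>

definition reaches :: "nat \<Rightarrow> program \<Rightarrow> nat \<Rightarrow> config \<Rightarrow> config \<Rightarrow> bool" where
  "reaches w p c \<sigma> \<tau> \<longleftrightarrow> (\<exists>t\<le>c. ((\<lambda>\<sigma> \<tau>. step w p \<sigma> = Some \<tau>) ^^ t) \<sigma> \<tau>)"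

lemma reaches_refl: "reaches w p c \<sigma> \<sigma>"
  unfolding reaches_def by (rule exI[of _ 0]) simp

lemma reaches_step: "step w p \<sigma> = Some \<tau> \<Longrightarrow> 1 \<le> c \<Longrightarrow> reaches w p c \<sigma> \<tau>"
  unfolding reaches_def by (rule exI[of _ 1]) (simp add: OO_def)

lemma reaches_trans:
  assumes "reaches w p c \<sigma> \<tau>" "reaches w p d \<tau> \<upsilon>"
  shows "reaches w p (c + d) \<sigma> \<upsilon>"
proof -
  obtain t u where "t \<le> c" "u \<le> d"
    "((\<lambda>\<sigma> \<tau>. step w p \<sigma> = Some \<tau>) ^^ t) \<sigma> \<tau>" "((\<lambda>\<sigma> \<tau>. step w p \<sigma> = Some \<tau>) ^^ u) \<tau> \<upsilon>"
    using assms unfolding reaches_def by blast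
  then show ?thesis
    unfolding reaches_def by (intro exI[of _ "t + u"]) (auto simp: relpowp_add)
qed

lemma reaches_mono: "reaches w p c \<sigma> \<tau> \<Longrightarrow> c \<le> d \<Longrightarrow> reaches w p d \<sigma> \<tau>"
  unfolding reaches_def using le_trans by blast

lemma reaches_halts_in:
  assumes "reaches w p c (0, r, M) (pc, r', M')" "pc < length p" "p ! pc = Halt"
  shows "\<exists>t\<le>c. halts_in w p t r M r' M'"
  using assms unfolding reaches_def halts_in_def by blast

section \<open>Straight-line code inside a program with absolute addresses\<close>

definition code_at :: "program \<Rightarrow> nat \<Rightarrow> instr list \<Rightarrow> bool" where
  "code_at p l is \<longleftrightarrow> (\<forall>i<length is. l + i < length p \<and> p ! (l + i) = is ! i)"

lemma code_at_Cons:
  "code_at p l (i # is) \<longleftrightarrow> l < length p \<and> p ! l = i \<and> code_at p (Suc l) is"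
  unfolding code_at_def by (auto simp: nth_Cons less_Suc_eq_0_disj split: nat.splits)

lemma code_at_Nil: "code_at p l []"
  by (simp add: code_at_def)

lemma code_at_append:
  "code_at p l (is @ js) \<longleftrightarrow> code_at p l is \<and> code_at p (l + length is) js"
  by (induction "is" arbitrary: l) (auto simp: code_at_Cons code_at_Nil)

lemma code_at_self: "code_at p 0 p"
  by (simp add: code_at_def)

text \<open>The value \<open>None\<close> for \<open>Jz\<close> and \<open>Halt\<close> restricts
  \<open>exec\<close> to straight-line code, whose execution is plain rewriting.\<close>

fun effect :: "nat \<Rightarrow> instr \<Rightarrow> registers \<times> memory \<Rightarrow> (registers \<times> memory) option" where
  "effect w (Const d c) (r, M) = Some (r(d := c mod 2 ^ w), M)"
| "effect w (Op f d a b) (r, M) = Some (r(d := binop_sem w f (r a) (r b)), M)"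
| "effect w (Load d a) (r, M) = (if r a < length M then Some (r(d := M ! r a), M) else None)"
| "effect w (Store a x) (r, M) = (if r a < length M then Some (r, M[r a := r x]) else None)"
| "effect w (Jz x l) s = None"
| "effect w Halt s = None"

fun exec :: "nat \<Rightarrow> instr list \<Rightarrow> registers \<times> memory \<Rightarrow> (registers \<times> memory) option" where
  "exec w [] s = Some s"
| "exec w (i # is) s = (case effect w i s of None \<Rightarrow> None | Some s' \<Rightarrow> exec w is s')"

lemma effect_step:
  assumes "effect w i (r, M) = Some (r', M')" "l < length p" "p ! l = i"
  shows "step w p (l, r, M) = Some (Suc l, r', M')"
  using assms by (cases i) (auto split: if_splits)

lemma exec_reaches:
  assumes "exec w is (r, M) = Some (r', M')" "code_at p l is"
  shows "reaches w p (length is) (l, r, M) (l + length is, r', M')"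
  using assms
proof (induction "is" arbitrary: l r M)
  case Nil
  then show ?case by (simp add: reaches_refl)
next
  case (Cons i "is")
  obtain r1 M1 where e: "effect w i (r, M) = Some (r1, M1)" "exec w is (r1, M1) = Some (r', M')"
    using Cons.prems(1) by (auto split: option.splits)
  have "reaches w p 1 (l, r, M) (Suc l, r1, M1)"
    using effect_step[OF e(1)] Cons.prems(2) by (intro reaches_step) (auto simp: code_at_Cons)
  moreover have "reaches w p (length is) (Suc l, r1, M1) (Suc l + length is, r', M')"
    using Cons.IH[OF e(2), of "Suc l"] Cons.prems(2) by (simp add: code_at_Cons)
  ultimately show ?case using reaches_trans by fastforce
qed

lemma exec_append:
  "exec w (is @ js) s = (case exec w is s of None \<Rightarrow> None | Some s' \<Rightarrow> exec w js s')"
  by (induction "is" arbitrary: s) (auto split: option.splits)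

fun instr_regs :: "instr \<Rightarrow> nat set" where
  "instr_regs (Const d c) = {d}"
| "instr_regs (Op f d a b) = {d, a, b}"
| "instr_regs (Load d a) = {d, a}"
| "instr_regs (Store a x) = {a, x}"
| "instr_regs (Jz x l) = {x}"
| "instr_regs Halt = {}"

text \<open>A bound is needed because the registers of the simulated program are reset before each
  run, by code of fixed length. The first three of them receive the arguments of an LCE
  query.\<close>

lemma program_regs_bounded:
  fixes p :: program
  obtains R where "3 \<le> R" "\<And>i. i \<in> set p \<Longrightarrow> instr_regs i \<subseteq> {..<R}"
proof -
  have fin: "finite (instr_regs i)" for i by (cases i) auto
  have "finite (\<Union> (instr_regs ` set p))" by (simp add: fin)
  then obtain R where "\<forall>x \<in> \<Union> (instr_regs ` set p). x < R"
    using finite_nat_set_iff_bounded by blast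
  then show ?thesis by (intro that[of "max 3 R"]) (auto simp: less_max_iff_disj)
qed

text \<open>
  Simulation with a larger word size: every instruction becomes a pair. Register \<open>i\<close> is kept in
  register \<open>i + 16\<close>, register 3 holds \<open>2 ^ w\<close> for the reduction to the simulated word size, register 4
  holds the offset of the simulated memory, and 7 and 8 are scratch registers. \<open>Halt\<close> jumps behind the
  simulated code.
\<close>

fun sim_fst :: "nat \<Rightarrow> instr \<Rightarrow> instr" where
  "sim_fst b (Const d c) = Const (d + 16) c"
| "sim_fst b (Op f d x y) = Op f (d + 16) (x + 16) (y + 16)"
| "sim_fst b (Load d a) = Op Add 8 (a + 16) 4"
| "sim_fst b (Store a x) = Op Add 8 (a + 16) 4"
| "sim_fst b (Jz x l) = Jz (x + 16) (b + 2 * l)"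
| "sim_fst b Halt = Const 7 0"

fun sim_snd :: "nat \<Rightarrow> instr \<Rightarrow> instr" where
  "sim_snd e (Const d c) = Op Mod (d + 16) (d + 16) 3"
| "sim_snd e (Op f d x y) = Op Mod (d + 16) (d + 16) 3"
| "sim_snd e (Load d a) = Load (d + 16) 8"
| "sim_snd e (Store a x) = Store 8 (x + 16)"
| "sim_snd e (Jz x l) = Const 7 0"
| "sim_snd e Halt = Jz 7 e"

definition sim :: "nat \<Rightarrow> program \<Rightarrow> program" where
  "sim b p = concat (map (\<lambda>i. [sim_fst b i, sim_snd (b + 2 * length p) i]) p)"

lemma nth_concat_pairs:
  assumes "n < length xs"
  shows "concat (map (\<lambda>x. [f x, g x]) xs) ! (2 * n) = f (xs ! n)"
    "concat (map (\<lambda>x. [f x, g x]) xs) ! Suc (2 * n) = g (xs ! n)"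
proof -
  have "concat (map (\<lambda>x. [f x, g x]) xs) ! (2 * n) = f (xs ! n) \<and>
    concat (map (\<lambda>x. [f x, g x]) xs) ! Suc (2 * n) = g (xs ! n)"
    using assms
  proof (induction xs arbitrary: n)
    case (Cons x xs)
    then show ?case by (cases n) simp_all
  qed simp
  then show "concat (map (\<lambda>x. [f x, g x]) xs) ! (2 * n) = f (xs ! n)"
    "concat (map (\<lambda>x. [f x, g x]) xs) ! Suc (2 * n) = g (xs ! n)" by auto
qed

lemma length_sim: "length (sim b p) = 2 * length p"
proof -
  have "length (concat (map (\<lambda>x. [f x, g x]) xs)) = 2 * length xs" for f g :: "instr \<Rightarrow> instr" and xs
    by (induction xs) auto
  then show ?thesis by (simp add: sim_def)
qed

lemma code_at_sim:
  assumes "code_at P b (sim b p)" "pc < length p"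
  shows "b + 2 * pc < length P" "P ! (b + 2 * pc) = sim_fst b (p ! pc)"
    "Suc (b + 2 * pc) < length P" "P ! Suc (b + 2 * pc) = sim_snd (b + 2 * length p) (p ! pc)"
proof -
  have l: "2 * pc < length (sim b p)" "Suc (2 * pc) < length (sim b p)"
    using assms(2) by (auto simp: length_sim)
  have c: "b + i < length P \<and> P ! (b + i) = sim b p ! i" if "i < length (sim b p)" for i
    using assms(1) that unfolding code_at_def by blast
  show "b + 2 * pc < length P" "P ! (b + 2 * pc) = sim_fst b (p ! pc)"
    using c[OF l(1)] nth_concat_pairs(1)[OF assms(2)] by (simp_all add: sim_def)
  show "Suc (b + 2 * pc) < length P" "P ! Suc (b + 2 * pc) = sim_snd (b + 2 * length p) (p ! pc)"
    using c[OF l(2)] nth_concat_pairs(2)[OF assms(2)] by (simp_all add: sim_def)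
qed

text \<open>As \<open>2 ^ w\<close> divides \<open>2 ^ w'\<close>, wrapping around at the larger
  modulus and then reducing agrees with wrapping around at the smaller one. The condition
  \<open>0 < w\<close> makes the result 1 of \<open>Less\<close> a word.\<close>

lemma binop_sem_mod:
  assumes "w \<le> w'" "a < 2 ^ w" "b < 2 ^ w" "0 < w"
  shows "binop_sem w' f a b mod 2 ^ w = binop_sem w f a b" "binop_sem w f a b < 2 ^ w"
proof -
  have d: "(2::nat) ^ w dvd 2 ^ w'" using assms(1) by (rule le_imp_power_dvd)
  have mm: "x mod 2 ^ w' mod 2 ^ w = x mod 2 ^ w" for x :: nat
    using d by (rule mod_mod_cancel)
  obtain k where k: "(2::nat) ^ w' = 2 ^ w * Suc k"
  proof -
    obtain j where j: "(2::nat) ^ w' = 2 ^ w * j" using d by (auto simp: dvd_def)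
    then have "j \<noteq> 0" by (intro notI) simp
    then show ?thesis using that j by (metis not0_implies_Suc)
  qed
  \<comment> \<open>Because \<open>b < 2 ^ w\<close>, no subtraction is truncated, and the two sides
    differ by the multiple \<open>2 ^ w * k\<close> of the small modulus.\<close>
  have sub: "(a + 2 ^ w' - b) mod 2 ^ w = (a + 2 ^ w - b) mod 2 ^ w"
  proof -
    have "a + 2 ^ w' - b = (a + 2 ^ w - b) + 2 ^ w * k" using assms(3) k by simp
    then show ?thesis by simp
  qed
  have one: "(1::nat) < 2 ^ w" using assms(4) by (metis one_less_numeral_iff one_less_power semiring_norm(76))
  have div: "a div x < 2 ^ w" for x using assms(2) by (meson div_le_dividend le_less_trans)
  have md: "a mod x < 2 ^ w" for x using assms(2) by (meson mod_less_eq_dividend le_less_trans)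
  have "Bit_Operations.and a b < 2 ^ w" "Bit_Operations.or a b < 2 ^ w" "Bit_Operations.xor a b < 2 ^ w"
    using assms(2,3) by (simp_all add: take_bit_nat_eq_self_iff[symmetric])
  then show "binop_sem w f a b < 2 ^ w"
    using div md one by (cases f) auto
  then show "binop_sem w' f a b mod 2 ^ w = binop_sem w f a b"
    using sub one by (cases f) (auto simp: mm)
qed

section \<open>The simulation invariant\<close>

definition sim_rel :: "nat \<Rightarrow> nat \<Rightarrow> nat \<Rightarrow> registers \<Rightarrow> registers \<Rightarrow> bool" where
  "sim_rel w R L r \<rho> \<longleftrightarrow>
    (\<forall>i<R. \<rho> (i + 16) = r i \<and> r i < 2 ^ w) \<and> \<rho> 3 = 2 ^ w \<and> \<rho> 4 = L"

text \<open>These registers of the host must survive a simulated query. Registers 7 and 8 are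
  scratch, and register 10 is reloaded in every round.\<close>

definition keeps :: "registers \<Rightarrow> registers \<Rightarrow> bool" where
  "keeps \<rho> \<rho>' \<longleftrightarrow> (\<forall>i\<in>{0, 1, 2, 3, 4, 5, 6, 9}. \<rho>' i = \<rho> i)"

text \<open>\<open>X\<close> is the data of the host in front of the simulated memory; it stays
  intact because all simulated addresses are shifted by \<open>length X\<close>. The bound
  \<open>length X + 2 ^ w \<le> 2 ^ w'\<close> keeps this shift from wrapping around.\<close>

lemma sim_step:
  assumes "step w p (pc, r, M) = Some (pc', r', M')"
    and regs: "\<And>i. i \<in> set p \<Longrightarrow> instr_regs i \<subseteq> {..<R}"
    and code: "code_at P b (sim b p)"
    and w: "w < w'" "0 < w" "length X + 2 ^ w \<le> 2 ^ w'"
    and rel: "sim_rel w R (length X) r \<rho>" and M: "set M \<subseteq> {..<2 ^ w}"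
  obtains \<rho>' where "reaches w' P 2 (b + 2 * pc, \<rho>, X @ M) (b + 2 * pc', \<rho>', X @ M')"
    "sim_rel w R (length X) r' \<rho>'" "keeps \<rho> \<rho>'" "set M' \<subseteq> {..<2 ^ w}"
proof -
  note finish = that
  have pc: "pc < length p" using assms(1) by (auto split: if_splits)
  note P = code_at_sim[OF code pc]
  have rg: "instr_regs (p ! pc) \<subseteq> {..<R}" using regs pc by simp
  have c2: "code_at P (b + 2 * pc) [sim_fst b (p ! pc), sim_snd (b + 2 * length p) (p ! pc)]"
    using P by (simp add: code_at_Cons code_at_Nil)
  have straight: thesis
    if e: "exec w' [sim_fst b (p ! pc), sim_snd (b + 2 * length p) (p ! pc)] (\<rho>, X @ M) = Some (\<rho>', X @ M')"
      and "pc' = Suc pc" "sim_rel w R (length X) r' \<rho>'" "keeps \<rho> \<rho>'" "set M' \<subseteq> {..<2 ^ w}" for \<rho>'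
    using exec_reaches[OF e c2] that(2-) by (intro finish[of \<rho>']) (auto simp: numeral_2_eq_2)
  have v: "\<And>i. i < R \<Longrightarrow> \<rho> (i + 16) = r i" "\<And>i. i < R \<Longrightarrow> r i < 2 ^ w" "\<rho> 3 = 2 ^ w" "\<rho> 4 = length X"
    using rel by (auto simp: sim_rel_def)
  have addr: "(r a + length X) mod 2 ^ w' = r a + length X" if "a < R" for a
    using v(2)[OF that] w(3) by simp
  have dd: "x mod 2 ^ w' mod 2 ^ w = x mod (2::nat) ^ w" for x
    using w(1) by (simp add: le_imp_power_dvd mod_mod_cancel)
  show thesis
  proof (cases "p ! pc")
    case (Const d c)
    then have s: "pc' = Suc pc" "r' = r(d := c mod 2 ^ w)" "M' = M" using assms(1) pc by auto
    show thesis
      using Const M rel s(1,3)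
      by (intro straight[of "\<rho>(d + 16 := c mod 2 ^ w)"]) (auto simp: sim_rel_def keeps_def dd s(2))
  next
    case (Op f d x y)
    then have s: "pc' = Suc pc" "r' = r(d := binop_sem w f (r x) (r y))" "M' = M"
      using assms(1) pc by auto
    have b: "binop_sem w' f (r x) (r y) mod 2 ^ w = binop_sem w f (r x) (r y)"
      "binop_sem w f (r x) (r y) < 2 ^ w"
      using binop_sem_mod[of w w' "r x" "r y" f] w v(2) rg Op by auto
    define z where "z = binop_sem w f (r x) (r y)"
    have "exec w' [sim_fst b (p ! pc), sim_snd (b + 2 * length p) (p ! pc)] (\<rho>, X @ M) =
        Some (\<rho>(d + 16 := z), X @ M')"
      using b(1) v(1)[of x] v(1)[of y] v(3) rg Op z_def s(3) by simp
    then show thesis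
      using b(2) M rel s
      by (intro straight[of "\<rho>(d + 16 := z)"]) (auto simp: sim_rel_def keeps_def z_def)
  next
    case (Load d a)
    then have a: "r a < length M" "a < R" and s: "pc' = Suc pc" "r' = r(d := M ! r a)" "M' = M"
      using assms(1) pc rg by (auto split: if_splits)
    have "M ! r a < 2 ^ w" using M a(1) by (meson lessThan_iff nth_mem subsetD)
    moreover have "exec w' [sim_fst b (p ! pc), sim_snd (b + 2 * length p) (p ! pc)] (\<rho>, X @ M) =
        Some (\<rho>(8 := r a + length X, d + 16 := M ! r a), X @ M')"
      using v(1)[OF a(2)] v(4) addr[OF a(2)] a(1) Load s(3) by (simp add: nth_append)
    ultimately show thesis using M rel s
      by (intro straight[of "\<rho>(8 := r a + length X, d + 16 := M ! r a)"])
        (auto simp: sim_rel_def keeps_def)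
  next
    case (Store a x)
    then have a: "r a < length M" "a < R" "x < R"
      and s: "pc' = Suc pc" "r' = r" "M' = M[r a := r x]"
      using assms(1) pc rg by (auto split: if_splits)
    have "set M' \<subseteq> {..<2 ^ w}"
      unfolding s(3)
      using M v(2)[OF a(3)] by (meson insert_subset lessThan_iff order_trans set_update_subset_insert)
    moreover have "exec w' [sim_fst b (p ! pc), sim_snd (b + 2 * length p) (p ! pc)] (\<rho>, X @ M) =
        Some (\<rho>(8 := r a + length X), X @ M')"
      using v(1)[OF a(2)] v(1)[OF a(3)] v(4) addr[OF a(2)] a(1) Store s(3)
      by (simp add: list_update_append)
    ultimately show thesis using rel s
      by (intro straight[of "\<rho>(8 := r a + length X)"]) (auto simp: sim_rel_def keeps_def)
  next
    case (Jz x l)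
    then have x: "x < R" using rg by auto
    have s: "step w' P (b + 2 * pc, \<rho>, X @ M) =
        Some (if r x = 0 then b + 2 * l else Suc (b + 2 * pc), \<rho>, X @ M)"
      using P v(1)[OF x] Jz by simp
    have st: "pc' = (if r x = 0 then l else Suc pc)" "r' = r" "M' = M" using assms(1) pc Jz by auto
    show thesis
    proof (cases "r x = 0")
      case True
      then show thesis using s st rel M
        by (intro finish[of \<rho>]) (auto intro!: reaches_step simp: keeps_def)
    next
      case False
      let ?\<rho> = "\<rho>(7 := 0)"
      have "step w' P (Suc (b + 2 * pc), \<rho>, X @ M) = Some (b + 2 * Suc pc, ?\<rho>, X @ M)"
        using P Jz by simp
      then have "reaches w' P (1 + 1) (b + 2 * pc, \<rho>, X @ M) (b + 2 * Suc pc, ?\<rho>, X @ M)"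
        using s False by (intro reaches_trans[OF reaches_step reaches_step]) auto
      then show thesis using False st rel M
        by (intro finish[of ?\<rho>]) (auto simp: keeps_def sim_rel_def numeral_2_eq_2)
    qed
  next
    case Halt
    then show thesis using assms(1) pc by simp
  qed
qed

lemma keeps_trans: "keeps \<rho> \<rho>' \<Longrightarrow> keeps \<rho>' \<rho>'' \<Longrightarrow> keeps \<rho> \<rho>''"
  by (simp add: keeps_def)

lemma sim_run:
  assumes "((\<lambda>\<sigma> \<tau>. step w p \<sigma> = Some \<tau>) ^^ t) (pc, r, M) (pc', r', M')"
    and regs: "\<And>i. i \<in> set p \<Longrightarrow> instr_regs i \<subseteq> {..<R}"
    and code: "code_at P b (sim b p)"
    and w: "w < w'" "0 < w" "length X + 2 ^ w \<le> 2 ^ w'"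
    and rel: "sim_rel w R (length X) r \<rho>" and M: "set M \<subseteq> {..<2 ^ w}"
  shows "\<exists>\<rho>'. reaches w' P (2 * t) (b + 2 * pc, \<rho>, X @ M) (b + 2 * pc', \<rho>', X @ M') \<and>
    sim_rel w R (length X) r' \<rho>' \<and> keeps \<rho> \<rho>' \<and> set M' \<subseteq> {..<2 ^ w}"
  using assms(1)
proof (induction t arbitrary: pc' r' M')
  case 0
  then show ?case using rel M by (auto intro!: exI[of _ \<rho>] simp: reaches_refl keeps_def)
next
  case (Suc t)
  then obtain pc1 r1 M1 where 1: "((\<lambda>\<sigma> \<tau>. step w p \<sigma> = Some \<tau>) ^^ t) (pc, r, M) (pc1, r1, M1)"
    "step w p (pc1, r1, M1) = Some (pc', r', M')" by (auto simp: OO_def)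
  from Suc.IH[OF 1(1)] obtain \<rho>1 where 2:
    "reaches w' P (2 * t) (b + 2 * pc, \<rho>, X @ M) (b + 2 * pc1, \<rho>1, X @ M1)"
    "sim_rel w R (length X) r1 \<rho>1" "keeps \<rho> \<rho>1" "set M1 \<subseteq> {..<2 ^ w}" by blast
  obtain \<rho>' where "reaches w' P 2 (b + 2 * pc1, \<rho>1, X @ M1) (b + 2 * pc', \<rho>', X @ M')"
    "sim_rel w R (length X) r' \<rho>'" "keeps \<rho>1 \<rho>'" "set M' \<subseteq> {..<2 ^ w}"
    using sim_step[OF 1(2) regs code w 2(2,4)] by blast
  then show ?case
    using keeps_trans[OF 2(3)] reaches_trans[OF 2(1), of 2] by (intro exI[of _ \<rho>']) auto
qed

lemma sim_halts_in:
  assumes "halts_in w p t r M r' M'"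
    and regs: "\<And>i. i \<in> set p \<Longrightarrow> instr_regs i \<subseteq> {..<R}"
    and code: "code_at P b (sim b p)"
    and w: "w < w'" "0 < w" "length X + 2 ^ w \<le> 2 ^ w'"
    and rel: "sim_rel w R (length X) r \<rho>" and M: "set M \<subseteq> {..<2 ^ w}"
  obtains \<rho>' where "reaches w' P (2 * t + 2) (b, \<rho>, X @ M) (b + 2 * length p, \<rho>', X @ M')"
    "sim_rel w R (length X) r' \<rho>'" "keeps \<rho> \<rho>'" "set M' \<subseteq> {..<2 ^ w}"
proof -
  obtain pc where pc: "((\<lambda>\<sigma> \<tau>. step w p \<sigma> = Some \<tau>) ^^ t) (0, r, M) (pc, r', M')"
    "pc < length p" "p ! pc = Halt" using assms(1) unfolding halts_in_def by blast
  obtain \<rho>1 where 1: "reaches w' P (2 * t) (b, \<rho>, X @ M) (b + 2 * pc, \<rho>1, X @ M')"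
    "sim_rel w R (length X) r' \<rho>1" "keeps \<rho> \<rho>1" "set M' \<subseteq> {..<2 ^ w}"
    using sim_run[OF pc(1) regs code w rel M] by auto
  \<comment> \<open>\<open>halts_in\<close> stops in front of \<open>Halt\<close>. The pair that
    replaces it clears register 7 and then jumps on it, hence two extra steps.\<close>
  let ?\<rho> = "\<rho>1(7 := 0)"
  note P = code_at_sim[OF code pc(2)]
  have "step w' P (b + 2 * pc, \<rho>1, X @ M') = Some (Suc (b + 2 * pc), ?\<rho>, X @ M')"
    "step w' P (Suc (b + 2 * pc), ?\<rho>, X @ M') = Some (b + 2 * length p, ?\<rho>, X @ M')"
    using P pc(3) by auto
  then have "reaches w' P (1 + 1) (b + 2 * pc, \<rho>1, X @ M') (b + 2 * length p, ?\<rho>, X @ M')"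
    by (intro reaches_trans[OF reaches_step reaches_step]) auto
  then have "reaches w' P (2 * t + 2) (b, \<rho>, X @ M) (b + 2 * length p, ?\<rho>, X @ M')"
    using reaches_trans[OF 1(1)] by (metis one_add_one)
  then show thesis using 1 by (intro that[of ?\<rho>]) (auto simp: keeps_def sim_rel_def)
qed

section \<open>The tree of blocks and keys\<close>

text \<open>Parents given by a function are unique, and a rank that drops from child to parent
  forces every chain of parents to end in 0.\<close>

lemma rooted_tree_by_parents:
  assumes "0 < m"
    and "\<And>a. 0 < a \<Longrightarrow> a < m \<Longrightarrow> par a < m \<and> rank (par a) < (rank a :: nat)"
  shows "rooted_tree m 0 {(par a, a) | a. 0 < a \<and> a < m}"
proof -
  have "(0, a) \<in> {(par a, a) | a. 0 < a \<and> a < m}\<^sup>*" if "a < m" for a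
    using that
  proof (induction "rank a" arbitrary: a rule: less_induct)
    case less
    show ?case
    proof (cases "a = 0")
      case False
      then have "(0, par a) \<in> {(par a, a) | a. 0 < a \<and> a < m}\<^sup>*"
        using less assms(2)[of a] by blast
      moreover have "(par a, a) \<in> {(par a, a) | a. 0 < a \<and> a < m}"
        using False less.prems by blast
      ultimately show ?thesis by (rule rtrancl_into_rtrancl)
    qed simp
  qed
  then show ?thesis
    unfolding rooted_tree_def using assms by auto
qed

section \<open>Path prefixes and their strings\<close>

lemma length_path_string: "length (path_string lab xs) = length xs - 1"
  by (simp add: path_string_def)

lemma nth_path_string:
  "Suc i < length xs \<Longrightarrow> path_string lab xs ! i = lab (xs ! i, xs ! Suc i)"
  by (simp add: path_string_def nth_tl)

lemma path_string_eqI: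
  assumes "length xs = length ys"
    and "\<And>i. Suc i < length xs \<Longrightarrow> lab (xs ! i, xs ! Suc i) = lab (ys ! i, ys ! Suc i)"
  shows "path_string lab xs = path_string lab ys"
proof (rule nth_equalityI)
  show "length (path_string lab xs) = length (path_string lab ys)"
    by (simp only: length_path_string assms(1))
next
  fix i assume "i < length (path_string lab xs)"
  then have i: "Suc i < length xs" "Suc i < length ys"
    using assms(1) by (simp_all only: length_path_string less_diff_conv add.commute plus_1_eq_Suc)
  show "path_string lab xs ! i = path_string lab ys ! i"
    by (simp only: nth_path_string i assms(2))
qed

lemma down_path_prefix_nth:
  assumes "down_path E v w xs" "prefix ps xs" "Suc i < length ps"
  shows "(ps ! i, ps ! Suc i) \<in> E"
proof -
  obtain zs where xs: "xs = ps @ zs" using assms(2) by (rule prefixE)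
  have "(xs ! i, xs ! Suc i) \<in> E"
    using assms xs unfolding down_path_def successively_conv_nth by simp
  then show ?thesis using assms(3) xs by (simp add: nth_append)
qed

lemma down_path_prefix_0:
  assumes "down_path E v w xs" "prefix ps xs" "ps \<noteq> []"
  shows "ps ! 0 = v"
proof -
  obtain zs where "xs = ps @ zs" using assms(2) by (rule prefixE)
  then show ?thesis using assms(1,3) unfolding down_path_def by (simp add: hd_conv_nth nth_append)
qed

text \<open>Extends any common prefix to a longest one, so that a single long common prefix refutes
  the maximality of a shorter answer. It exists because \<open>xs\<close> bounds the length.\<close>

lemma ex_lce_path_path:
  assumes "equal_path_prefixes lab xs ys z"
  shows "\<exists>z'. lce_path_path lab xs ys z' \<and> length (fst z) \<le> length (fst z')"
proof -
  have "\<forall>z. equal_path_prefixes lab xs ys z \<longrightarrow> length (fst z) < Suc (length xs)"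
    by (auto simp: equal_path_prefixes_def less_Suc_eq_le prefix_length_le)
  then obtain z' where "equal_path_prefixes lab xs ys z'"
    "\<forall>y. equal_path_prefixes lab xs ys y \<longrightarrow> length (fst y) \<le> length (fst z')"
    using ex_has_greatest_nat[of "equal_path_prefixes lab xs ys" z "\<lambda>z. length (fst z)"] assms by blast
  then show ?thesis using assms unfolding lce_path_path_def by blast
qed

text \<open>
  The pair \<open>(i, y)\<close> stands for the prefix \<open>y\<close> that remains of a \<open>D\<close>-digit number after removing its \<open>i\<close>
  last base-4 digits; so the root is \<open>(D, 0)\<close> and the leaves are the keys, at height 0.
\<close>

definition trie_nodes :: "nat set \<Rightarrow> nat \<Rightarrow> (nat \<times> nat) set" where
  "trie_nodes S D = insert (D, 0) ((\<lambda>(x, i). (i, x div 4 ^ i)) ` (S \<times> {..D}))"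

text \<open>At height \<open>D\<close> all keys share the trie root, so each key contributes at most
  \<open>D\<close> further nodes.\<close>

lemma card_trie_nodes:
  assumes "finite S" "S \<subseteq> {..<4 ^ D}"
  shows "finite (trie_nodes S D)" "card (trie_nodes S D) \<le> card S * D + 1"
proof -
  show fin: "finite (trie_nodes S D)" using assms by (simp add: trie_nodes_def)
  let ?I = "(\<lambda>(x, i). (i, x div 4 ^ i)) ` (S \<times> {..<D})"
  have "trie_nodes S D \<subseteq> insert (D, 0) ?I"
  proof
    fix u assume "u \<in> trie_nodes S D"
    then consider "u = (D, 0)" | x i where "x \<in> S" "i \<le> D" "u = (i, x div 4 ^ i)"
      by (auto simp: trie_nodes_def)
    then show "u \<in> insert (D, 0) ?I"
    proof cases
      case (2 x i)
      have "x div 4 ^ D = 0" using assms(2) 2(1) by auto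
      then show ?thesis using 2 by (cases "i = D") auto
    qed simp
  qed
  then have "card (trie_nodes S D) \<le> card (insert (D, 0) ?I)"
    using assms(1) by (intro card_mono finite.insertI finite_imageI finite_cartesian_product) simp_all
  also have "\<dots> \<le> Suc (card ?I)"
    using assms(1) by (simp add: card_insert_if)
  also have "card ?I \<le> card (S \<times> {..<D})"
    using assms(1) by (intro card_image_le) simp
  finally show "card (trie_nodes S D) \<le> card S * D + 1" by (simp add: card_cartesian_product)
qed

text \<open>
  The tree has root 0, then \<open>4 ^ c\<close> disjoint paths spelling all blocks of \<open>c\<close> digits, then the trie of
  the keys numbered by \<open>num\<close>, and all remaining numbers below \<open>m\<close> are children of the root. This
  padding reaches the exact size \<open>m\<close>, which matters because no monotonicity of the bounds is known.
\<close>

locale trie_tree =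
  fixes S :: "nat set" and c D m :: nat and num :: "nat \<times> nat \<Rightarrow> nat"
  assumes finite_S: "finite S" and S_bound: "S \<subseteq> {..<4 ^ D}"
    and inj_num: "inj_on num (trie_nodes S D)"
    and num_range: "num ` trie_nodes S D \<subseteq> {Suc (4 ^ c * Suc c)..<m}"
begin

abbreviation "N \<equiv> trie_nodes S D"
abbreviation "node \<equiv> inv_into N num"

text \<open>Block \<open>v\<close> occupies \<open>Suc c\<close> consecutive numbers after the root
  0. Hence both ends of its path are computed arithmetically, and depths on one path are compared by
  comparing numbers.\<close>

definition path_node :: "nat \<Rightarrow> nat \<Rightarrow> nat" where
  "path_node v i = Suc (v * Suc c + i)"

definition parent :: "nat \<Rightarrow> nat" where
  "parent a =
    (if a \<le> 4 ^ c * Suc c then (if (a - 1) mod Suc c = 0 then 0 else a - 1)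
     else if a \<in> num ` (N - {(D, 0)}) then num (Suc (fst (node a)), snd (node a) div 4)
     else 0)"

definition E :: "(nat \<times> nat) set" where
  "E = {(parent a, a) | a. 0 < a \<and> a < m}"

text \<open>An edge is labelled by its lower end. On a block path at depth \<open>i\<close>, the
  exponent \<open>c - i\<close> selects the \<open>i\<close>-th digit of the block from the left; in
  the trie the label is the last digit of the prefix.\<close>

definition label :: "nat \<times> nat \<Rightarrow> nat" where
  "label e = (let a = snd e in
    if a \<le> 4 ^ c * Suc c then (a - 1) div Suc c div 4 ^ (c - (a - 1) mod Suc c) mod 4
    else snd (node a) mod 4)"

lemma root_in: "(D, 0) \<in> N"
  by (simp add: trie_nodes_def)

lemma mem_N_iff:
  "(i, y) \<in> N \<longleftrightarrow> i = D \<and> y = 0 \<or> i < D \<and> (\<exists>z\<in>S. y = z div 4 ^ i)"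
proof -
  have "z div 4 ^ D = 0" if "z \<in> S" for z using S_bound that by auto
  then show ?thesis unfolding trie_nodes_def by (auto simp: le_less)
qed

lemma N_up: "(i, y) \<in> N \<Longrightarrow> i < D \<Longrightarrow> (Suc i, y div 4) \<in> N"
proof -
  assume "(i, y) \<in> N" "i < D"
  then obtain z where z: "z \<in> S" "y = z div 4 ^ i" using mem_N_iff by auto
  have "y div 4 = z div 4 ^ Suc i" using z(2) by (simp add: div_mult2_eq[symmetric] mult.commute)
  moreover have "z div 4 ^ Suc i = 0" if "Suc i = D" using that z(1) S_bound by auto
  ultimately show ?thesis using \<open>i < D\<close> z(1) unfolding mem_N_iff
    by (cases "Suc i = D") auto
qed

lemma node_num: "u \<in> N \<Longrightarrow> node (num u) = u"
  using inj_num by (rule inv_into_f_f)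

lemma num_bounds: "u \<in> N \<Longrightarrow> 4 ^ c * Suc c < num u \<and> num u < m"
  using num_range by (auto simp: image_subset_iff Suc_le_eq)

lemma m_pos: "4 ^ c * Suc c < m" "2 \<le> m"
proof -
  show l: "4 ^ c * Suc c < m" using num_bounds[OF root_in] by simp
  have "0 < (4::nat) ^ c * Suc c" by simp
  then show "2 \<le> m" using l by linarith
qed

lemma path_node_le: "v < 4 ^ c \<Longrightarrow> i \<le> c \<Longrightarrow> path_node v i \<le> 4 ^ c * Suc c"
proof -
  assume v: "v < 4 ^ c" "i \<le> c"
  then have "Suc v * Suc c \<le> 4 ^ c * Suc c" by (intro mult_le_mono1) simp
  then show ?thesis using v by (simp add: path_node_def)
qed

lemma rooted: "rooted_tree m 0 E"
proof -
  \<comment> \<open>On block paths the number itself drops towards the root. In the trie the depth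
    does, increased by one to stay above the rank 0 of the root.\<close>
  define rank where "rank a =
    (if a \<le> 4 ^ c * Suc c then a else if a \<in> num ` N then Suc (D - fst (node a)) else 1)" for a
  have "parent a < m \<and> rank (parent a) < rank a" if a: "0 < a" "a < m" for a
  proof -
    consider "a \<le> 4 ^ c * Suc c" | i y where "4 ^ c * Suc c < a" "a = num (i, y)" "(i, y) \<in> N" "(i, y) \<noteq> (D, 0)"
      | "4 ^ c * Suc c < a" "a \<notin> num ` (N - {(D, 0)})"
      proof (cases "a \<in> num ` (N - {(D, 0)})")
      case True
      then obtain u where "u \<in> N - {(D, 0)}" "a = num u" by (rule imageE)
      then show thesis using that(2)[of "fst u" "snd u"] num_bounds[of u] by auto
    qed (use that(1,3) not_less in blast)
    then show ?thesis
    proof cases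
      case 1
      then show ?thesis using a m_pos by (auto simp: parent_def rank_def)
    next
      case (2 i y)
      then have i: "i < D" using mem_N_iff by auto
      note up = N_up[OF 2(3) i]
      have mem: "a \<in> num ` (N - {(D, 0)})" using 2 by blast
      have par: "parent a = num (Suc i, y div 4)"
        using 2 mem by (simp add: parent_def node_num)
      have "rank (parent a) = Suc (D - Suc i)"
        using num_bounds[OF up] up unfolding par rank_def by (auto simp: node_num)
      moreover have "rank a = Suc (D - i)"
        using 2 unfolding rank_def by (auto simp: node_num)
      ultimately show ?thesis using num_bounds[OF up] par i by auto
    next
      case 3
      then show ?thesis using a by (auto simp: parent_def rank_def)
    qed
  qed
  then show ?thesis unfolding E_def using m_pos by (intro rooted_tree_by_parents[of m parent rank]) auto
qed

section \<open>Edges and labels of the block paths and of the trie\<close>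

lemma label_lt: "label e < 4"
  by (simp add: label_def Let_def)

lemma path_node_div_mod:
  assumes "i \<le> c"
  shows "(path_node v i - 1) div Suc c = v" "(path_node v i - 1) mod Suc c = i"
proof -
  have "(v * Suc c + i) div Suc c = v + i div Suc c" by (rule div_mult_self3) simp
  then show "(path_node v i - 1) div Suc c = v"
    using assms unfolding path_node_def diff_Suc_1 by simp
  have "(v * Suc c + i) mod Suc c = i mod Suc c" by (rule mod_mult_self3)
  then show "(path_node v i - 1) mod Suc c = i"
    using assms unfolding path_node_def diff_Suc_1 by simp
qed

lemma path_edge:
  assumes "v < 4 ^ c" "i < c"
  shows "(path_node v i, path_node v (Suc i)) \<in> E"
proof -
  have "path_node v (Suc i) \<le> 4 ^ c * Suc c" using assms by (intro path_node_le) auto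
  then have "parent (path_node v (Suc i)) = path_node v i"
    using path_node_div_mod(2)[of "Suc i" v] assms(2) unfolding parent_def by (simp add: path_node_def)
  then show ?thesis using path_node_le[OF assms(1), of "Suc i"] assms(2) m_pos
    unfolding E_def by (intro CollectI exI[of _ "path_node v (Suc i)"]) (auto simp: path_node_def)
qed

lemma path_label:
  assumes "v < 4 ^ c" "i < c"
  shows "label (a, path_node v (Suc i)) = v div 4 ^ (c - Suc i) mod 4"
proof -
  have "path_node v (Suc i) \<le> 4 ^ c * Suc c" using assms by (intro path_node_le) auto
  then show ?thesis
    using path_node_div_mod[of "Suc i" v] assms(2) unfolding label_def Let_def snd_conv by simp
qed

lemma parent_trie_cases:
  assumes "4 ^ c * Suc c < a"
  obtains "parent a = 0"
    | i y where "i < D" "(i, y) \<in> N" "a = num (i, y)" "parent a = num (Suc i, y div 4)"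
proof (cases "a \<in> num ` (N - {(D, 0)})")
  case True
  then obtain u where "u \<in> N - {(D, 0)}" "a = num u" by (rule imageE)
  moreover obtain i y where "u = (i, y)" by (cases u)
  ultimately have u: "(i, y) \<in> N" "i < D" "a = num (i, y)" using mem_N_iff[of i y] by auto
  then have "parent a = num (Suc i, y div 4)"
    using True assms by (simp add: parent_def node_num)
  then show thesis using that(2) u by blast
qed (use that(1) assms in \<open>simp add: parent_def\<close>)

text \<open>The number following the end of a path is not its child: it starts another block below
  the root or lies beyond all paths. Parents inside the trie have larger numbers than all path
  nodes.\<close>

lemma path_child:
  assumes "v < 4 ^ c" "i \<le> c" "(path_node v i, z) \<in> E"
  shows "i < c \<and> z = path_node v (Suc i)"
proof -
  have z: "0 < z" "parent z = path_node v i" using assms(3) by (auto simp: E_def)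
  show ?thesis
  proof (cases "z \<le> 4 ^ c * Suc c")
    case True
    then have z1: "(z - 1) mod Suc c \<noteq> 0" "z - 1 = path_node v i"
      using z by (auto simp: parent_def path_node_def split: if_splits)
    then have "z - 1 = v * Suc c + Suc i" by (simp add: path_node_def)
    moreover have "(v * Suc c + Suc c) mod Suc c = 0"
      by (metis mod_add_self2 mod_mult_self2_is_0)
    ultimately have "i \<noteq> c" using z1(1) by metis
    then show ?thesis using assms(2) z1(2) z(1) by (simp add: path_node_def)
  next
    case False
    then have "4 ^ c * Suc c < z" by simp
    then show ?thesis
    proof (cases rule: parent_trie_cases)
      case 1
      then show ?thesis using z by (simp add: path_node_def)
    next
      case (2 j y)
      then show ?thesis using num_bounds[OF N_up[OF 2(2,1)]] path_node_le[OF assms(1,2)] z by simp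
    qed
  qed
qed

lemma trie_edge:
  assumes "(i, y) \<in> N" "i < D"
  shows "(num (Suc i, y div 4), num (i, y)) \<in> E"
proof -
  have "num (i, y) \<in> num ` (N - {(D, 0)})" using assms by blast
  then have "parent (num (i, y)) = num (Suc i, y div 4)"
    using num_bounds[OF assms(1)] by (simp add: parent_def node_num[OF assms(1)])
  then show ?thesis using num_bounds[OF assms(1)] unfolding E_def by force
qed

lemma trie_label: "u \<in> N \<Longrightarrow> label (a, num u) = snd u mod 4"
  using num_bounds[of u] by (simp add: label_def node_num)

lemma trie_child:
  assumes "(h, y) \<in> N" "(num (h, y), z) \<in> E"
  obtains y' where "0 < h" "(h - 1, y') \<in> N" "y' div 4 = y" "z = num (h - 1, y')"
proof -
  have z: "0 < z" "parent z = num (h, y)" using assms(2) by (auto simp: E_def)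
  then have "4 ^ c * Suc c < z" using num_bounds[OF assms(1)]
    by (auto simp: parent_def split: if_splits)
  then show thesis
  proof (cases rule: parent_trie_cases)
    case 1
    then show ?thesis using z num_bounds[OF assms(1)] by simp
  next
    case (2 j y')
    then have "(Suc j, y' div 4) = (h, y)"
      using inj_onD[OF inj_num _ N_up[OF 2(2,1)] assms(1)] z by simp
    then show ?thesis using 2 that[of y'] by auto
  qed
qed

text \<open>The block ends at height \<open>h - c\<close>, and reduction modulo \<open>4 ^ c\<close>
  removes only digits above it, so the digits inside are those of \<open>x\<close>.\<close>

lemma digit_of_block:
  fixes x :: nat
  assumes "i < c" "c \<le> h"
  shows "(x div 4 ^ (h - c) mod 4 ^ c) div 4 ^ (c - Suc i) mod 4 = x div 4 ^ (h - Suc i) mod 4"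
proof -
  let ?y = "x div 4 ^ (h - c)"
  have c: "(4::nat) ^ c = 4 ^ (c - Suc i) * (4 * 4 ^ i)"
    using assms(1) by (simp flip: power_Suc power_add)
  have "?y mod 4 ^ c div 4 ^ (c - Suc i) = ?y div 4 ^ (c - Suc i) mod (4 * 4 ^ i)"
    unfolding c mod_mult2_eq by simp
  also have "\<dots> mod 4 = ?y div 4 ^ (c - Suc i) mod 4"
    by (simp add: mod_mod_cancel)
  also have "?y div 4 ^ (c - Suc i) = x div 4 ^ (h - c + (c - Suc i))"
    by (simp add: div_mult2_eq power_add)
  also have "h - c + (c - Suc i) = h - Suc i" using assms by simp
  finally show ?thesis .
qed

lemma div_digit_eq:
  fixes x :: nat
  assumes "0 < h"
  shows "x div 4 ^ (h - 1) = 4 * (x div 4 ^ h) + x div 4 ^ (h - 1) mod 4"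
proof -
  have "x div 4 ^ h = x div 4 ^ (h - 1) div 4"
    using assms div_mult2_eq[of x "4 ^ (h - 1)" 4] power_minus_mult[of h "4::nat"] by simp
  then show ?thesis by simp
qed

text \<open>LCE candidates range over paths that end in leaves; following a key down to height 0
  supplies such a path.\<close>

lemma key_path:
  assumes "z \<in> S" "h \<le> D"
  defines "ys \<equiv> map (\<lambda>t. num (h - t, z div 4 ^ (h - t))) [0..<Suc h]"
  shows "down_path E (num (h, z div 4 ^ h)) (num (0, z)) ys" "leaf E (num (0, z))"
proof -
  have mem: "(i, z div 4 ^ i) \<in> N" if "i \<le> D" for i
    using assms(1) that by (force simp: trie_nodes_def)
  have "(num (h - t, z div 4 ^ (h - t)), num (h - Suc t, z div 4 ^ (h - Suc t))) \<in> E"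
    if "t < h" for t
  proof -
    have "h - t = Suc (h - Suc t)" "z div 4 ^ (h - t) = z div 4 ^ (h - Suc t) div 4"
      using that div_mult2_eq[of z "4 ^ (h - Suc t)" 4]
      by (simp_all add: Suc_diff_Suc flip: power_Suc2)
    then show ?thesis
      using trie_edge[of "h - Suc t" "z div 4 ^ (h - Suc t)"] mem[of "h - Suc t"] that assms(2) by simp
  qed
  then have "successively (\<lambda>x y. (x, y) \<in> E) ys"
    unfolding ys_def successively_conv_nth by (auto simp del: upt_Suc)
  then show "down_path E (num (h, z div 4 ^ h)) (num (0, z)) ys"
    unfolding down_path_def by (auto simp: ys_def hd_conv_nth last_conv_nth simp del: upt_Suc)
  show "leaf E (num (0, z))"
    unfolding leaf_def
  proof (intro allI notI)
    fix u assume "(num (0, z), u) \<in> E"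
    moreover have "(0, z) \<in> N" using mem[of 0] by simp
    ultimately show False using trie_child[of 0 z u] by blast
  qed
qed

lemma block_path:
  assumes "v < 4 ^ c"
  shows "down_path E (path_node v 0) (path_node v c) (map (path_node v) [0..<Suc c])"
proof -
  have "successively (\<lambda>x y. (x, y) \<in> E) (map (path_node v) [0..<Suc c])"
    unfolding successively_conv_nth
  proof (intro allI impI)
    fix i assume "Suc i < length (map (path_node v) [0..<Suc c])"
    then show "(map (path_node v) [0..<Suc c] ! i, map (path_node v) [0..<Suc c] ! Suc i) \<in> E"
      using path_edge[OF assms, of i] by (simp del: upt_Suc)
  qed
  then show ?thesis
    unfolding down_path_def by (simp add: hd_conv_nth last_conv_nth del: upt_Suc)
qed

lemma block_query:
  assumes "v < 4 ^ c" "u \<in> N"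
  shows "[path_node v 0, path_node v c, num u] \<in> lce_pt_queries m E"
proof -
  have "(path_node v 0, path_node v i) \<in> E\<^sup>*" if "i \<le> c" for i
    using that
  proof (induction i)
    case (Suc i)
    then have "(path_node v 0, path_node v i) \<in> E\<^sup>*" by simp
    then show ?case by (rule rtrancl_into_rtrancl) (use path_edge[OF assms(1), of i] Suc.prems in simp)
  qed simp
  then have "(path_node v 0, path_node v c) \<in> E\<^sup>*" by simp
  moreover have "path_node v 0 < m"
    using path_node_le[OF assms(1), of 0] m_pos(1) by (rule le_less_trans) simp
  ultimately show ?thesis
    using num_bounds[OF assms(2)] unfolding lce_pt_queries_def by blast
qed

text \<open>Both prefixes of the answer are forced: the block path does not branch, and equal labels
  make the trie side follow the digits of \<open>x\<close>. Had the answer stopped too early, a key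
  below the next trie node would give a longer candidate.\<close>

lemma block_answer:
  assumes x: "(h, x div 4 ^ h) \<in> N" "c \<le> h"
  defines "v \<equiv> x div 4 ^ (h - c) mod 4 ^ c"
  assumes "lce_pt_answer E label [path_node v 0, path_node v c, num (h, x div 4 ^ h)] a"
  shows "\<exists>j\<le>c. fst a = path_node v j \<and> snd a = num (h - j, x div 4 ^ (h - j)) \<and>
    (h - j, x div 4 ^ (h - j)) \<in> N \<and> (j < c \<longrightarrow> (h - Suc j, x div 4 ^ (h - Suc j)) \<notin> N)"
proof -
  let ?y = "\<lambda>t. (h - t, x div 4 ^ (h - t))"
  let ?r = "num (h, x div 4 ^ h)"
  have v: "v < 4 ^ c" by (simp add: v_def)
  have hD: "h \<le> D" using x(1) mem_N_iff by auto
  obtain ps qs where lce: "lce_path_tree E label (path_node v 0) (path_node v c) ?r (ps, qs)"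
    and a: "a = (last ps, last qs)"
    using assms(4) unfolding lce_pt_answer_def by auto
  obtain xs ys l where paths: "down_path E (path_node v 0) (path_node v c) xs" "down_path E ?r l ys"
    and pp: "lce_path_path label xs ys (ps, qs)"
    using lce unfolding lce_path_tree_def lce_candidate_def by blast
  have eq: "ps \<noteq> []" "qs \<noteq> []" "prefix ps xs" "prefix qs ys" "path_string label ps = path_string label qs"
    using pp by (auto simp: lce_path_path_def equal_path_prefixes_def)
  have len: "length qs = length ps"
    using arg_cong[OF eq(5), of length] eq(1,2) unfolding length_path_string
    by (metis One_nat_def Suc_pred length_greater_0_conv)
  have ps: "t < length ps \<longrightarrow> t \<le> c \<and> ps ! t = path_node v t" for t
  proof (induction t)
    case 0
    then show ?case using down_path_prefix_0[OF paths(1) eq(3,1)] by simp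
  next
    case (Suc t)
    then show ?case
      using down_path_prefix_nth[OF paths(1) eq(3), of t] path_child[OF v, of t] by fastforce
  qed
  \<comment> \<open>The parent fixes the quotient of the next prefix by 4, the equal labels fix its
    remainder.\<close>
  have qs: "t < length ps \<longrightarrow> ?y t \<in> N \<and> qs ! t = num (?y t)" for t
  proof (induction t)
    case 0
    then show ?case using down_path_prefix_0[OF paths(2) eq(4,2)] x(1) by simp
  next
    case (Suc t)
    show ?case
    proof
      assume t: "Suc t < length ps"
      then have tc: "t < c" using ps[of "Suc t"] by simp
      have yt: "?y t \<in> N" "qs ! t = num (?y t)" using Suc t by auto
      have "(num (?y t), qs ! Suc t) \<in> E"
        using down_path_prefix_nth[OF paths(2) eq(4), of t] t len yt(2) by simp
      then obtain y' where y': "0 < h - t" "(h - t - 1, y') \<in> N" "y' div 4 = x div 4 ^ (h - t)"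
        "qs ! Suc t = num (h - t - 1, y')"
        using trie_child[OF yt(1)] by metis
      have "label (ps ! t, ps ! Suc t) = label (qs ! t, qs ! Suc t)"
        using arg_cong[OF eq(5), of "\<lambda>s. s ! t"] t len by (simp add: nth_path_string)
      then have "y' mod 4 = x div 4 ^ (h - Suc t) mod 4"
        using path_label[OF v tc] ps[of "Suc t"] t y'(4) trie_label[OF y'(2)] digit_of_block[OF tc x(2)]
        by (simp add: v_def)
      then have "y' = x div 4 ^ (h - Suc t)"
        using div_digit_eq[of "h - t" x] y'(1,3) by (metis diff_Suc_eq_diff_pred diff_commute mult_div_mod_eq)
      then show "?y (Suc t) \<in> N \<and> qs ! Suc t = num (?y (Suc t))" using y' by simp
    qed
  qed
  define j where "j = length ps - 1"
  have j: "j < length ps" "last ps = ps ! j" "last qs = qs ! j"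
    using eq(1,2) len by (auto simp: j_def last_conv_nth)
  have "?y (Suc j) \<notin> N" if jc: "j < c"
  proof
    assume "?y (Suc j) \<in> N"
    \<comment> \<open>A trie node below the root is a prefix of some key \<open>z\<close>, whose
      leaf completes the competing candidate.\<close>
    then obtain z where z: "z \<in> S" "x div 4 ^ (h - Suc j) = z div 4 ^ (h - Suc j)"
      using mem_N_iff jc x(2) hD by auto
    have above: "x div 4 ^ (h - t) = z div 4 ^ (h - t)" if "t \<le> Suc j" for t
    proof -
      have "h - t = (h - Suc j) + (Suc j - t)" using that jc x(2) by simp
      then show ?thesis using z(2) by (metis div_mult2_eq power_add)
    qed
    let ?xs = "map (path_node v) [0..<Suc c]"
    let ?ys = "map (\<lambda>t. num (h - t, z div 4 ^ (h - t))) [0..<Suc h]"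
    \<comment> \<open>\<open>j + 2\<close> nodes spell \<open>j + 1\<close> characters, one more
      than the \<open>j\<close> characters of the answer.\<close>
    let ?z = "(take (j + 2) ?xs, take (j + 2) ?ys)"
    have "path_string label (fst ?z) = path_string label (snd ?z)"
    proof (rule path_string_eqI)
      show "length (fst ?z) = length (snd ?z)" using jc x(2) by simp
    next
      fix i assume "Suc i < length (fst ?z)"
      then have i: "i \<le> j" "i < c" using jc by auto
      have mem: "(h - Suc i, z div 4 ^ (h - Suc i)) \<in> N"
        using z(1) hD i x(2) by (force simp: trie_nodes_def)
      have "label (path_node v i, path_node v (Suc i)) = x div 4 ^ (h - Suc i) mod 4"
        using path_label[OF v i(2)] digit_of_block[OF i(2) x(2)] by (simp add: v_def)
      then show "label (fst ?z ! i, fst ?z ! Suc i) = label (snd ?z ! i, snd ?z ! Suc i)"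
        using i jc x(2) trie_label[OF mem] above[of "Suc i"]
        by (simp del: upt_Suc)
    qed
    then have "equal_path_prefixes label ?xs ?ys ?z"
      by (auto simp: equal_path_prefixes_def take_is_prefix simp del: upt_Suc)
    then obtain z' where z': "lce_path_path label ?xs ?ys z'" "length (fst ?z) \<le> length (fst z')"
      using ex_lce_path_path by blast
    have "lce_candidate E label (path_node v 0) (path_node v c) ?r z'"
      using block_path[OF v] key_path[OF z(1) hD] above[of 0] z'(1) unfolding lce_candidate_def by auto
    then have "length (fst z') \<le> length ps"
      using lce unfolding lce_path_tree_def by fastforce
    then show False using z'(2) jc by (simp add: j_def)
  qed
  then show ?thesis using ps[of j] qs[of j] j a by (intro exI[of _ j]) auto
qed

text \<open>Shifting by one frees 0 for a missing predecessor, so a single table word holds either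
  outcome.\<close>

definition pred_code :: "nat \<Rightarrow> nat" where
  "pred_code x = (if \<exists>y\<in>S. y \<le> x then Suc (Max {y \<in> S. y \<le> x}) else 0)"

lemma pred_code_answer:
  assumes "b = (if 0 < pred_code x then 1 else 0)" "0 < pred_code x \<Longrightarrow> y = pred_code x - 1"
  shows "predecessor_answer S [x] (b, y)"
proof -
  define P where "P \<longleftrightarrow> (\<exists>y\<in>S. y \<le> x)"
  define M where "M = Max {y \<in> S. y \<le> x}"
  have "pred_code x = (if P then Suc M else 0)"
    unfolding pred_code_def P_def M_def ..
  then have "if P then (b, y) = (1, M) else b = 0"
    using assms by (cases P) auto
  then show ?thesis
    unfolding predecessor_answer_def P_def M_def by (simp split: if_splits)
qed

lemma pred_code_le: "pred_code x \<le> 4 ^ D"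
proof -
  have "Max {y \<in> S. y \<le> x} < 4 ^ D" if "\<exists>y\<in>S. y \<le> x"
  proof -
    have "Max {y \<in> S. y \<le> x} \<in> {y \<in> S. y \<le> x}" using that finite_S by (intro Max_in) auto
    then show ?thesis using S_bound by blast
  qed
  then show ?thesis by (auto simp: pred_code_def Suc_le_eq)
qed

text \<open>
  When \<open>x\<close> leaves the trie below \<open>(i, y)\<close>, its next digit determines its predecessor: no key lies
  between the smallest number with the same leading digits and \<open>x\<close>. Hence four entries per node suffice.
\<close>

definition exit_pred :: "nat \<times> nat \<Rightarrow> nat \<Rightarrow> nat" where
  "exit_pred u d = pred_code (if fst u = 0 then snd u else (4 * snd u + d) * 4 ^ (fst u - 1))"

lemma exit_pred_eq:
  assumes "(i, x div 4 ^ i) \<in> N" "i = 0 \<or> (i - 1, x div 4 ^ (i - 1)) \<notin> N"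
  shows "exit_pred (i, x div 4 ^ i) (x div 4 ^ (i - 1) mod 4) = pred_code x"
proof (cases "i = 0")
  case True
  then show ?thesis by (simp add: exit_pred_def)
next
  case False
  let ?q = "x div 4 ^ (i - 1)"
  have q: "4 * (x div 4 ^ i) + ?q mod 4 = ?q" using div_digit_eq[of i x] False by simp
  have "i - 1 < D" using assms(1) False mem_N_iff by auto
  then have no: "z div 4 ^ (i - 1) \<noteq> ?q" if "z \<in> S" for z
    using assms(2) False that mem_N_iff by metis
  \<comment> \<open>No key has the prefix \<open>?q\<close>, so a key up to \<open>x\<close> has a
    strictly smaller prefix and stays below the rounded number.\<close>
  have "z \<le> ?q * 4 ^ (i - 1)" if "z \<in> S" "z \<le> x" for z
  proof -
    have "z div 4 ^ (i - 1) < ?q" using no[OF that(1)] div_le_mono[OF that(2), of "4 ^ (i - 1)"] by linarith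
    then show ?thesis
      by (metis div_less_iff_less_mult less_imp_le zero_less_numeral zero_less_power)
  qed
  moreover have "?q * 4 ^ (i - 1) \<le> x" by (rule div_times_less_eq_dividend)
  ultimately have "z \<le> ?q * 4 ^ (i - 1) \<longleftrightarrow> z \<le> x" if "z \<in> S" for z
    using that le_trans by blast
  then have "pred_code (?q * 4 ^ (i - 1)) = pred_code x"
    unfolding pred_code_def by (simp cong: conj_cong bex_cong)
  then show ?thesis using False q by (simp add: exit_pred_def)
qed

end

section \<open>The predecessor program\<close>

lemma exec_reaches':
  assumes "exec w is (r, M) = Some (r', M')" "code_at p l is" "length is = n" "l + n = l'"
  shows "reaches w p n (l, r, M) (l', r', M')"
  using exec_reaches[OF assms(1,2)] assms(3,4) by simp

text \<open>\<open>input_regs\<close> demands zeros beyond the arguments, so leftovers of the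
  previous simulated query must be erased.\<close>

lemma exec_clear:
  "exec w (map (\<lambda>i. Const (i + k) 0) [0..<R]) (\<rho>, M) =
    Some (\<lambda>i. if k \<le> i \<and> i < R + k then 0 else \<rho> i, M)"
proof (induction R)
  case (Suc R)
  have "(\<lambda>i. if k \<le> i \<and> i < R + k then 0 else \<rho> i)(R + k := 0) =
      (\<lambda>i. if k \<le> i \<and> i < Suc R + k then 0 else \<rho> i)"
    by (auto simp: fun_eq_iff)
  then show ?case by (simp add: exec_append Suc)
next
  case 0
  have "\<rho> = (\<lambda>i. if k \<le> i \<and> i < k then 0 else \<rho> i)" by (auto simp: fun_eq_iff)
  then show ?case by simp
qed

text \<open>
  Register 0 holds the query, register 2 the current trie node, registers 3 to 6 the constants \<open>2 ^ w\<close>,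
  offset, \<open>4 ^ c\<close> and \<open>c\<close> from the header of the memory, and register 9 the end of the current block path.
  A round of the loop moves down by one block of digits with a single LCE query.
\<close>

definition prelude :: "instr list" where
  "prelude = [Const 7 0, Load 3 7, Const 7 1, Load 4 7, Const 7 2, Load 5 7, Const 7 3, Load 6 7,
    Const 7 4, Load 2 7]"

definition loop_head :: "instr list" where
  "loop_head = [Const 7 6, Op Mul 8 7 2, Const 7 5, Op Add 8 8 7, Load 10 8]"

definition block_ends :: "instr list" where
  "block_ends = [Op Div 10 0 10, Op Mod 10 10 5, Const 7 1, Op Add 8 6 7, Op Mul 10 10 8,
    Op Add 10 10 7, Op Add 9 10 6]"

text \<open>The instruction set has no move between registers; adding register 7, set to 0, copies a
  word.\<close>

definition query_args :: "instr list" where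
  "query_args = [Const 7 0, Op Add 16 10 7, Op Add 17 9 7, Op Add 18 2 7]"

text \<open>Registers 16 and 17 are the simulated registers 0 and 1, the two nodes of the answer.
  Register 8 becomes 1 exactly if the match stopped before the path end in register 9; otherwise the
  loop continues.\<close>

definition advance :: "instr list" where
  "advance = [Const 7 0, Op Add 2 17 7, Op Less 8 16 9]"

text \<open>After the five header words, field 1 of node \<open>u\<close> is at address
  \<open>6 * u + 6\<close>, and the entry for digit \<open>d\<close> lies \<open>d + 1\<close>
  further. If the entry is 0, the subtraction wraps around, but register 0 then reports that there
  is no predecessor.\<close>

definition lookup :: "instr list" where
  "lookup = [Const 7 6, Op Mul 8 7 2, Op Add 8 8 7, Load 10 8, Op Div 10 0 10, Const 7 4,
    Op Mod 10 10 7, Op Add 8 8 10, Const 7 1, Op Add 8 8 7, Load 10 8, Op Sub 1 10 7,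
    Const 7 0, Op Less 0 7 10]"

lemma code_lengths:
  "length prelude = 10" "length loop_head = 5" "length block_ends = 7" "length query_args = 4"
  "length advance = 3" "length lookup = 14"
  by (simp_all add: prelude_def loop_head_def block_ends_def query_args_def advance_def lookup_def)

text \<open>The pieces before the clearing code have \<open>10 + 5 + 1 + 7 = 23\<close>
  instructions; \<open>R\<close> for clearing and 4 for the arguments follow.\<close>

definition sim_start :: "nat \<Rightarrow> nat" where
  "sim_start R = 27 + R"

definition exit_addr :: "nat \<Rightarrow> program \<Rightarrow> nat" where
  "exit_addr R p = sim_start R + 2 * length p + 4"

definition pred_program :: "nat \<Rightarrow> program \<Rightarrow> program" where
  "pred_program R p = prelude @ loop_head @ [Jz 10 (exit_addr R p)] @ block_ends @
    map (\<lambda>i. Const (i + 16) 0) [0..<R] @ query_args @ sim (sim_start R) p @ advance @ [Jz 8 10] @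
    lookup @ [Halt]"

lemma pred_program_code:
  defines "P n \<equiv> pred_program n"
  shows "code_at (P R p) 0 prelude" "code_at (P R p) 10 loop_head"
    "code_at (P R p) 15 [Jz 10 (exit_addr R p)]" "code_at (P R p) 16 block_ends"
    "code_at (P R p) 23 (map (\<lambda>i. Const (i + 16) 0) [0..<R])" "code_at (P R p) (23 + R) query_args"
    "code_at (P R p) (sim_start R) (sim (sim_start R) p)"
    "code_at (P R p) (sim_start R + 2 * length p) advance"
    "code_at (P R p) (sim_start R + 2 * length p + 3) [Jz 8 10]"
    "code_at (P R p) (exit_addr R p) lookup" "code_at (P R p) (exit_addr R p + 14) [Halt]"
proof -
  have "code_at (P R p) 0 (P R p)" by (rule code_at_self)
  then show "code_at (P R p) 0 prelude" "code_at (P R p) 10 loop_head"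
    "code_at (P R p) 15 [Jz 10 (exit_addr R p)]" "code_at (P R p) 16 block_ends"
    "code_at (P R p) 23 (map (\<lambda>i. Const (i + 16) 0) [0..<R])" "code_at (P R p) (23 + R) query_args"
    "code_at (P R p) (sim_start R) (sim (sim_start R) p)"
    "code_at (P R p) (sim_start R + 2 * length p) advance"
    "code_at (P R p) (sim_start R + 2 * length p + 3) [Jz 8 10]"
    "code_at (P R p) (exit_addr R p) lookup" "code_at (P R p) (exit_addr R p + 14) [Halt]"
    unfolding P_def pred_program_def code_at_append
    by (simp_all add: code_lengths length_sim sim_start_def exit_addr_def algebra_simps)
qed

text \<open>\<open>w\<close> is the word size of the given structure, \<open>w'\<close> that of the
  predecessor machine. In \<open>w'_bound\<close>, the first part makes every address of the table
  with the simulated memory behind it a word, the second every divisor and encoded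
  predecessor.\<close>

locale reduction = trie_tree +
  fixes w w' k R T :: nat and p :: program and \<M> :: "memory set"
  assumes c_pos: "0 < c" and D_eq: "D = c * k"
    and w_pos: "0 < w" and m_le: "m \<le> 2 ^ w"
    and w'_bound: "2 ^ w + 5 + 6 * m < 2 ^ w'" "4 ^ D < (2::nat) ^ w'"
    and R_ge: "3 \<le> R" and regs: "\<And>i. i \<in> set p \<Longrightarrow> instr_regs i \<subseteq> {..<R}"
    and words: "\<And>M. M \<in> \<M> \<Longrightarrow> set M \<subseteq> {..<2 ^ w}"
    and answers: "\<And>M args. M \<in> \<M> \<Longrightarrow> args \<in> lce_pt_queries m E \<Longrightarrow>
      \<exists>t r' M'. halts_in w p t (input_regs args) M r' M' \<and> t \<le> T \<and> M' \<in> \<M> \<and>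
        lce_pt_answer E label args (r' 0, r' 1)"
begin

abbreviation "P \<equiv> pred_program R p"

text \<open>
  Each node has six words: the divisor that shifts the next block of \<open>x\<close> to the end (0 below height \<open>c\<close>,
  which stops the loop at a leaf), the divisor for the next digit, and the encoded predecessor for each
  of the four values of that digit. At leaves, where \<open>4 ^ (0 - 1) = 1\<close>, these four entries agree.
\<close>

definition field :: "nat \<Rightarrow> nat \<Rightarrow> nat" where
  "field f u = (if u \<notin> num ` N then 0 else let i = fst (node u) in
    if f = 0 then (if c \<le> i then 4 ^ (i - c) else 0)
    else if f = 1 then 4 ^ (i - 1)
    else exit_pred (node u) (f - 2))"

definition table :: memory where
  "table = [2 ^ w, 5 + 6 * m, 4 ^ c, c, num (D, 0)] @ map (\<lambda>a. field (a mod 6) (a div 6)) [0..<6 * m]"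

lemma length_table: "length table = 5 + 6 * m"
  by (simp add: table_def)

lemma table_field:
  assumes "u < m" "f < 6"
  shows "table ! (5 + 6 * u + f) = field f u" "5 + 6 * u + f < 5 + 6 * m"
proof -
  have "(6 * u + f) div 6 = u" "(6 * u + f) mod 6 = f" "6 * u + f < 6 * m" using assms by auto
  then show "table ! (5 + 6 * u + f) = field f u" by (simp add: table_def nth_append)
  show "5 + 6 * u + f < 5 + 6 * m" using \<open>6 * u + f < 6 * m\<close> by simp
qed

lemma node_le: "(i, y) \<in> N \<Longrightarrow> i \<le> D"
  using mem_N_iff by auto

lemma field_lt: "field f u < 2 ^ w'"
proof (cases "u \<in> num ` N")
  case True
  then have i: "fst (node u) \<le> D" using node_le node_num by auto
  have "field f u \<le> 4 ^ D"
    using True i pred_code_le unfolding field_def by (auto simp: Let_def exit_pred_def)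
  then show ?thesis using w'_bound(2) by simp
qed (simp add: field_def)

lemma table_words: "set table \<subseteq> {..<2 ^ w'}"
proof -
  have "c \<le> 4 ^ c" "(4::nat) ^ c \<le> 4 ^ c * Suc c"
    using less_exp[of c] power_mono[of 2 "4::nat" c] by auto
  then have "c < m" "4 ^ c < m" using m_pos(1) by linarith+
  moreover have "num (D, 0) < m" using num_bounds[OF root_in] by simp
  ultimately have "{2 ^ w, 5 + 6 * m, 4 ^ c, c, num (D, 0)} \<subseteq> {..<2 ^ w'}"
    using w'_bound(1) unfolding insert_subset lessThan_iff by (intro conjI) (linarith | simp)+
  then show ?thesis using field_lt by (auto simp: table_def)
qed

lemma field_num:
  assumes "(i, y) \<in> N"
  shows "field 0 (num (i, y)) = (if c \<le> i then 4 ^ (i - c) else 0)"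
    "field (Suc 0) (num (i, y)) = 4 ^ (i - 1)"
    "field (d + 2) (num (i, y)) = exit_pred (i, y) d"
  using assms by (simp_all add: field_def node_num)

definition regs_ok :: "nat \<Rightarrow> registers \<Rightarrow> bool" where
  "regs_ok x \<rho> \<longleftrightarrow> \<rho> 0 = x \<and> \<rho> 3 = 2 ^ w \<and> \<rho> 4 = length table \<and> \<rho> 5 = 4 ^ c \<and> \<rho> 6 = c"

section \<open>Arithmetic of the program without overflow\<close>

lemma word_facts:
  "2 ^ w < (2::nat) ^ w'" "w < w'" "a \<le> 6 * m + 5 \<Longrightarrow> a mod 2 ^ w' = a"
proof -
  show 1: "2 ^ w < (2::nat) ^ w'" using w'_bound(1) by linarith
  then show "w < w'" by simp
  show "a \<le> 6 * m + 5 \<Longrightarrow> a mod 2 ^ w' = a" using w'_bound(1) by (intro mod_less) linarith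
qed

lemma table_header:
  "table ! 0 = 2 ^ w" "table ! 1 = 5 + 6 * m" "table ! 2 = 4 ^ c" "table ! 3 = c" "table ! 4 = num (D, 0)"
  by (simp_all add: table_def)

lemma small_constants: "d \<le> (6::nat) \<Longrightarrow> d mod 2 ^ w' = d"
  using m_pos(2) by (intro word_facts(3)) linarith

lemma exec_Const: "d \<le> 6 \<Longrightarrow> exec w' (Const e d # is) (\<rho>, M) = exec w' is (\<rho>(e := d), M)"
  by (simp add: small_constants)

lemma exec_Op:
  "binop_sem w' f (\<rho> a) (\<rho> b) = v \<Longrightarrow>
    exec w' (Op f d a b # is) (\<rho>, M) = exec w' is (\<rho>(d := v), M)"
  by simp

lemma exec_Load:
  "\<rho> a < length table \<Longrightarrow> table ! (\<rho> a) = v \<Longrightarrow>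
    exec w' (Load d a # is) (\<rho>, table @ M) = exec w' is (\<rho>(d := v), table @ M)"
  by (simp add: nth_append)

section \<open>Running the pieces of the program\<close>

lemma prelude_run:
  assumes "\<rho> 0 = x"
  obtains \<rho>' where "reaches w' P 10 (0, \<rho>, table @ M) (10, \<rho>', table @ M)"
    "regs_ok x \<rho>'" "\<rho>' 2 = num (D, 0)"
proof -
  have "\<exists>\<rho>'. exec w' prelude (\<rho>, table @ M) = Some (\<rho>', table @ M) \<and> regs_ok x \<rho>' \<and> \<rho>' 2 = num (D, 0)"
    unfolding prelude_def using assms
    by (simp add: exec_Const exec_Load table_header table_header[simplified] length_table regs_ok_def del: exec.simps(2))
  then obtain \<rho>' where "exec w' prelude (\<rho>, table @ M) = Some (\<rho>', table @ M)" "regs_ok x \<rho>'" "\<rho>' 2 = num (D, 0)"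
    by blast
  then show thesis
    using that[of \<rho>'] exec_reaches'[OF _ pred_program_code(1) code_lengths(1)] by simp
qed

lemma head_run:
  assumes "regs_ok x \<rho>" "\<rho> 2 = num (h, y)" "(h, y) \<in> N"
  obtains \<rho>' where "reaches w' P 5 (10, \<rho>, table @ M) (15, \<rho>', table @ M)"
    "regs_ok x \<rho>'" "\<rho>' 2 = num (h, y)" "\<rho>' 10 = (if c \<le> h then 4 ^ (h - c) else 0)"
proof -
  let ?u = "num (h, y)"
  have u: "?u < m" using num_bounds[OF assms(3)] by simp
  have a: "(6 * ?u) mod 2 ^ w' = 6 * ?u" "(6 * ?u + 5) mod 2 ^ w' = 6 * ?u + 5"
    using u by (auto intro!: word_facts(3))
  have "\<exists>\<rho>'. exec w' loop_head (\<rho>, table @ M) = Some (\<rho>', table @ M) \<and> regs_ok x \<rho>' \<and> \<rho>' 2 = ?u \<and>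
      \<rho>' 10 = field 0 ?u"
    unfolding loop_head_def using assms(1,2) a table_field[OF u, of 0]
    by (simp add: exec_Const exec_Op exec_Load length_table regs_ok_def add.commute del: exec.simps(2))
  then obtain \<rho>' where r: "exec w' loop_head (\<rho>, table @ M) = Some (\<rho>', table @ M)" "regs_ok x \<rho>'"
    "\<rho>' 2 = ?u" "\<rho>' 10 = field 0 ?u"
    by blast
  have "reaches w' P 5 (10, \<rho>, table @ M) (15, \<rho>', table @ M)"
    using exec_reaches'[OF r(1) pred_program_code(2) code_lengths(2)] by simp
  then show thesis using r field_num(1)[OF assms(3)] by (intro that[of \<rho>']) auto
qed

lemma setup_run:
  assumes "regs_ok x \<rho>" "\<rho> 2 = u" "u < m" "\<rho> 10 = z"
  defines "v \<equiv> x div z mod 4 ^ c"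
  obtains \<rho>' where "reaches w' P (11 + R) (16, \<rho>, table @ M) (sim_start R, \<rho>', table @ M)"
    "regs_ok x \<rho>'" "\<rho>' 9 = path_node v c"
    "sim_rel w R (length table) (input_regs [path_node v 0, path_node v c, u]) \<rho>'"
proof -
  have v: "v < 4 ^ c" by (simp add: v_def)
  have pn: "path_node v i < m" if "i \<le> c" for i
    using path_node_le[OF v that] m_pos(1) by linarith
  have lt: "path_node v c < m" "path_node v 0 < m" using pn by auto
  have md: "Suc c mod 2 ^ w' = Suc c" "(v * Suc c) mod 2 ^ w' = v * Suc c"
    "(v * Suc c + 1) mod 2 ^ w' = v * Suc c + 1" "(v * Suc c + 1 + c) mod 2 ^ w' = v * Suc c + 1 + c"
    using lt m_pos(1) by (auto simp: path_node_def intro!: word_facts(3))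
  have dv: "x div z mod 4 ^ c = v" by (simp add: v_def)
  have p0: "path_node v 0 = v * Suc c + 1" "path_node v c = v * Suc c + 1 + c"
    by (simp_all add: path_node_def)
  have "\<exists>\<rho>'. exec w' block_ends (\<rho>, table @ M) = Some (\<rho>', table @ M) \<and> regs_ok x \<rho>' \<and> \<rho>' 2 = u \<and>
      \<rho>' 10 = path_node v 0 \<and> \<rho>' 9 = path_node v c"
    unfolding block_ends_def p0 using assms(1,2,4) md dv
    by (simp add: exec_Const exec_Op regs_ok_def del: exec.simps(2) mult_Suc_right)
  then obtain \<rho>1 where 1: "exec w' block_ends (\<rho>, table @ M) = Some (\<rho>1, table @ M)" "regs_ok x \<rho>1"
    "\<rho>1 2 = u" "\<rho>1 10 = path_node v 0" "\<rho>1 9 = path_node v c"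
    by blast
  define \<rho>2 where "\<rho>2 = (\<lambda>i. if 16 \<le> i \<and> i < R + 16 then 0 else \<rho>1 i)"
  define \<rho>3 where "\<rho>3 = \<rho>2(7 := 0, 16 := path_node v 0, 17 := path_node v c, 18 := u)"
  have md2: "path_node v 0 mod 2 ^ w' = path_node v 0" "path_node v c mod 2 ^ w' = path_node v c"
    "u mod 2 ^ w' = u"
    using lt assms(3) by (auto intro!: word_facts(3))
  have \<rho>2: "\<rho>2 10 = path_node v 0" "\<rho>2 9 = path_node v c" "\<rho>2 2 = u"
    using 1 by (auto simp: \<rho>2_def)
  have 3: "exec w' query_args (\<rho>2, table @ M) = Some (\<rho>3, table @ M)"
    unfolding query_args_def \<rho>3_def
    by (simp add: exec_Const exec_Op \<rho>2 md2 del: exec.simps(2))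
  have "reaches w' P 7 (16, \<rho>, table @ M) (23, \<rho>1, table @ M)"
    using exec_reaches'[OF 1(1) pred_program_code(4) code_lengths(3)] by simp
  moreover have "reaches w' P R (23, \<rho>1, table @ M) (23 + R, \<rho>2, table @ M)"
    unfolding \<rho>2_def by (rule exec_reaches'[OF exec_clear pred_program_code(5)]) simp_all
  moreover have "reaches w' P 4 (23 + R, \<rho>2, table @ M) (sim_start R, \<rho>3, table @ M)"
    using exec_reaches'[OF 3 pred_program_code(6) code_lengths(4)] by (simp add: sim_start_def)
  ultimately have "reaches w' P (7 + R + 4) (16, \<rho>, table @ M) (sim_start R, \<rho>3, table @ M)"
    using reaches_trans by blast
  moreover have "regs_ok x \<rho>3" "\<rho>3 9 = path_node v c"
    using 1(2,5) by (simp_all add: regs_ok_def \<rho>3_def \<rho>2_def)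
  moreover have "sim_rel w R (length table) (input_regs [path_node v 0, path_node v c, u]) \<rho>3"
  proof -
    have "\<rho>3 (i + 16) = input_regs [path_node v 0, path_node v c, u] i" if "i < R" for i
    proof -
      consider "i = 0" | "i = 1" | "i = 2" | "3 \<le> i" by linarith
      then show ?thesis using that
        by cases (simp_all add: input_regs_def \<rho>3_def \<rho>2_def)
    qed
    moreover have "input_regs [path_node v 0, path_node v c, u] i < 2 ^ w" for i
    proof -
      consider "i = 0" | "i = 1" | "i = 2" | "3 \<le> i" by linarith
      then show ?thesis using lt assms(3) m_le
        by cases (simp_all add: input_regs_def)
    qed
    ultimately show ?thesis
      using \<open>regs_ok x \<rho>3\<close> unfolding sim_rel_def regs_ok_def by blast
  qed
  ultimately show thesis by (intro that[of \<rho>3]) (simp_all add: add.commute)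
qed

lemma round_run:
  assumes "regs_ok x \<rho>" "\<rho> 2 = num (h, x div 4 ^ h)" "(h, x div 4 ^ h) \<in> N" "c \<le> h" "M \<in> \<M>"
  shows "\<exists>j\<le>c. \<exists>\<rho>' M'. reaches w' P (2 * T + R + 23) (10, \<rho>, table @ M)
      (if j < c then exit_addr R p else 10, \<rho>', table @ M') \<and>
    regs_ok x \<rho>' \<and> \<rho>' 2 = num (h - j, x div 4 ^ (h - j)) \<and> M' \<in> \<M> \<and> (h - j, x div 4 ^ (h - j)) \<in> N \<and>
    (j < c \<longrightarrow> (h - Suc j, x div 4 ^ (h - Suc j)) \<notin> N)"
proof -
  let ?u = "num (h, x div 4 ^ h)"
  define v where "v = x div 4 ^ (h - c) mod 4 ^ c"
  have v: "v < 4 ^ c" by (simp add: v_def)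
  have u: "?u < m" using num_bounds[OF assms(3)] by simp
  obtain \<rho>1 where 1: "reaches w' P 5 (10, \<rho>, table @ M) (15, \<rho>1, table @ M)"
    "regs_ok x \<rho>1" "\<rho>1 2 = ?u" "\<rho>1 10 = 4 ^ (h - c)"
    using head_run[OF assms(1-3)] assms(4) by metis
  have j1: "reaches w' P 1 (15, \<rho>1, table @ M) (16, \<rho>1, table @ M)"
    using pred_program_code(3)[of R p] 1(4) by (intro reaches_step) (auto simp: code_at_Cons)
  obtain \<rho>2 where 2: "reaches w' P (11 + R) (16, \<rho>1, table @ M) (sim_start R, \<rho>2, table @ M)"
    "regs_ok x \<rho>2" "\<rho>2 9 = path_node v c"
    "sim_rel w R (length table) (input_regs [path_node v 0, path_node v c, ?u]) \<rho>2"
    using setup_run[OF 1(2,3) u 1(4)] unfolding v_def by metis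
  obtain t r' M' where t: "halts_in w p t (input_regs [path_node v 0, path_node v c, ?u]) M r' M'"
    "t \<le> T" "M' \<in> \<M>" "lce_pt_answer E label [path_node v 0, path_node v c, ?u] (r' 0, r' 1)"
    using answers[OF assms(5) block_query[OF v assms(3)]] by blast
  obtain j where j: "j \<le> c" "r' 0 = path_node v j" "r' 1 = num (h - j, x div 4 ^ (h - j))"
    "(h - j, x div 4 ^ (h - j)) \<in> N" "j < c \<longrightarrow> (h - Suc j, x div 4 ^ (h - Suc j)) \<notin> N"
    using block_answer[OF assms(3,4) t(4)[unfolded v_def]] unfolding v_def by auto
  have len: "length table + 2 ^ w \<le> 2 ^ w'" using w'_bound(1) by (simp add: length_table)
  obtain \<rho>3 where 3: "reaches w' P (2 * t + 2) (sim_start R, \<rho>2, table @ M)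
      (sim_start R + 2 * length p, \<rho>3, table @ M')"
    "sim_rel w R (length table) r' \<rho>3" "keeps \<rho>2 \<rho>3"
    using sim_halts_in[OF t(1) regs pred_program_code(7) word_facts(2) w_pos len 2(4) words[OF assms(5)]] by blast
  define \<rho>4 where "\<rho>4 = \<rho>3(7 := 0, 2 := r' 1, 8 := if j < c then 1 else 0)"
  have \<rho>3: "\<rho>3 16 = r' 0" "\<rho>3 17 = r' 1" "\<rho>3 9 = path_node v c" "regs_ok x \<rho>3"
    using 3(2,3) 2(2,3) R_ge unfolding sim_rel_def keeps_def regs_ok_def
    by (auto dest: spec[of _ 0] spec[of _ 1])
  have "r' 1 mod 2 ^ w' = r' 1"
    using num_bounds[OF j(4)] j(3) by (intro word_facts(3)) linarith
  moreover have "path_node v j < path_node v c \<longleftrightarrow> j < c" by (simp add: path_node_def)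
  ultimately have "exec w' advance (\<rho>3, table @ M') = Some (\<rho>4, table @ M')"
    unfolding advance_def \<rho>4_def
    by (simp add: exec_Const exec_Op \<rho>3 j(2) del: exec.simps(2))
  then have 4: "reaches w' P 3 (sim_start R + 2 * length p, \<rho>3, table @ M')
      (sim_start R + 2 * length p + 3, \<rho>4, table @ M')"
    using exec_reaches'[OF _ pred_program_code(8) code_lengths(5)] by blast
  have 5: "reaches w' P 1 (sim_start R + 2 * length p + 3, \<rho>4, table @ M')
      (if j < c then exit_addr R p else 10, \<rho>4, table @ M')"
    using pred_program_code(9)[of R p]
    by (intro reaches_step) (auto simp: code_at_Cons \<rho>4_def exit_addr_def)
  \<comment> \<open>The summands are loop head, exit test, block arithmetic with clearing and
    arguments, simulated query, \<open>advance\<close>, and the final jump.\<close>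
  have "reaches w' P (5 + 1 + (11 + R) + (2 * t + 2) + 3 + 1) (10, \<rho>, table @ M)
      (if j < c then exit_addr R p else 10, \<rho>4, table @ M')"
    using reaches_trans[OF reaches_trans[OF reaches_trans[OF reaches_trans[OF reaches_trans[OF 1(1) j1] 2(1)] 3(1)] 4] 5] .
  then have "reaches w' P (2 * T + R + 23) (10, \<rho>, table @ M)
      (if j < c then exit_addr R p else 10, \<rho>4, table @ M')"
    by (rule reaches_mono) (use t(2) in simp)
  moreover have "regs_ok x \<rho>4" "\<rho>4 2 = num (h - j, x div 4 ^ (h - j))"
    using \<rho>3(4) j(3) by (simp_all add: regs_ok_def \<rho>4_def)
  ultimately show ?thesis using j t(3) by blast
qed

lemma lookup_run:
  assumes "regs_ok x \<rho>" "\<rho> 2 = num (i, x div 4 ^ i)" "(i, x div 4 ^ i) \<in> N"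
    "i = 0 \<or> (i - 1, x div 4 ^ (i - 1)) \<notin> N"
  obtains \<rho>' where "reaches w' P 14 (exit_addr R p, \<rho>, table @ M) (exit_addr R p + 14, \<rho>', table @ M)"
    "predecessor_answer S [x] (\<rho>' 0, \<rho>' 1)"
proof -
  let ?u = "num (i, x div 4 ^ i)"
  define d where "d = x div 4 ^ (i - 1) mod 4"
  have u: "?u < m" using num_bounds[OF assms(3)] by simp
  have d: "d < 4" by (simp add: d_def)
  have a: "(6 * ?u) mod 2 ^ w' = 6 * ?u" "(6 * ?u + 6) mod 2 ^ w' = 6 * ?u + 6"
    "(6 * ?u + 6 + d) mod 2 ^ w' = 6 * ?u + 6 + d" "(6 * ?u + 6 + d + 1) mod 2 ^ w' = 6 * ?u + 6 + d + 1"
    using u d by (auto intro!: word_facts(3))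
  have f1: "table ! (6 * ?u + 6) = 4 ^ (i - 1)" "6 * ?u + 6 < length table"
    using table_field[OF u, of 1] field_num(2)[OF assms(3)] by (simp_all add: length_table add.commute)
  have "field (d + 2) ?u = pred_code x"
    using field_num(3)[OF assms(3), of d] exit_pred_eq[OF assms(3,4)] by (simp add: d_def)
  then have f2: "table ! (6 * ?u + 6 + d + 1) = pred_code x" "6 * ?u + 6 + d + 1 < length table"
    using table_field[OF u, of "d + 2"] d by (simp_all add: length_table algebra_simps)
  have pc: "pred_code x < 2 ^ w'" using pred_code_le[of x] w'_bound(2) by linarith
  have sub: "(pred_code x + 2 ^ w' - 1) mod 2 ^ w' = pred_code x - 1" if "0 < pred_code x"
  proof -
    have "pred_code x + 2 ^ w' - 1 = pred_code x - 1 + 2 ^ w'" using that by linarith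
    moreover have "(pred_code x - 1) mod 2 ^ w' = pred_code x - 1"
      using pc by (intro mod_less) linarith
    ultimately show ?thesis by (simp only: mod_add_self2)
  qed
  have "\<exists>\<rho>'. exec w' lookup (\<rho>, table @ M) = Some (\<rho>', table @ M) \<and>
      \<rho>' 1 = (pred_code x + 2 ^ w' - 1) mod 2 ^ w' \<and> \<rho>' 0 = (if 0 < pred_code x then 1 else 0)"
    unfolding lookup_def using assms(1,2) a f1 f2
    by (simp add: exec_Const exec_Op exec_Load regs_ok_def flip: d_def del: exec.simps(2) One_nat_def add_Suc_right)
  then obtain \<rho>' where r: "exec w' lookup (\<rho>, table @ M) = Some (\<rho>', table @ M)"
    "\<rho>' 1 = (pred_code x + 2 ^ w' - 1) mod 2 ^ w'" "\<rho>' 0 = (if 0 < pred_code x then 1 else 0)" by blast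
  have "reaches w' P 14 (exit_addr R p, \<rho>, table @ M) (exit_addr R p + 14, \<rho>', table @ M)"
    using exec_reaches'[OF r(1) pred_program_code(10) code_lengths(6)] by blast
  then show thesis using pred_code_answer[of "\<rho>' 0" x "\<rho>' 1"] r sub by (intro that[of \<rho>']) auto
qed

text \<open>Full matches keep the height a multiple of \<open>c\<close>, so \<open>l\<close> counts
  the remaining blocks. A partial match leaves the loop at once, at a node where the next digit of
  \<open>x\<close> leads out of the trie.\<close>

lemma loop_run:
  assumes "regs_ok x \<rho>" "\<rho> 2 = num (c * l, x div 4 ^ (c * l))" "(c * l, x div 4 ^ (c * l)) \<in> N" "M \<in> \<M>"
  shows "\<exists>\<rho>' M'. reaches w' P (l * (2 * T + R + 23) + 20) (10, \<rho>, table @ M)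
      (exit_addr R p + 14, \<rho>', table @ M') \<and>
    M' \<in> \<M> \<and> predecessor_answer S [x] (\<rho>' 0, \<rho>' 1)"
  using assms
proof (induction l arbitrary: \<rho> M)
  case 0
  have mem: "(0, x div 4 ^ 0) \<in> N" using 0(3) by simp
  \<comment> \<open>At height 0, below \<open>c\<close>, the stored divisor is 0 and triggers the
    exit.\<close>
  obtain \<rho>1 where 1: "reaches w' P 5 (10, \<rho>, table @ M) (15, \<rho>1, table @ M)"
    "regs_ok x \<rho>1" "\<rho>1 2 = num (0, x div 4 ^ 0)" "\<rho>1 10 = 0"
    using head_run[OF 0(1) _ mem] 0(2) c_pos by (metis mult_0_right not_le)
  have 2: "reaches w' P 1 (15, \<rho>1, table @ M) (exit_addr R p, \<rho>1, table @ M)"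
    using pred_program_code(3)[of R p] 1(4) by (intro reaches_step) (auto simp: code_at_Cons)
  obtain \<rho>' where 3: "reaches w' P 14 (exit_addr R p, \<rho>1, table @ M) (exit_addr R p + 14, \<rho>', table @ M)"
    "predecessor_answer S [x] (\<rho>' 0, \<rho>' 1)"
    using lookup_run[OF 1(2,3) mem] by metis
  have "reaches w' P (5 + 1 + 14) (10, \<rho>, table @ M) (exit_addr R p + 14, \<rho>', table @ M)"
    using reaches_trans[OF reaches_trans[OF 1(1) 2] 3(1)] .
  then show ?case using 3(2) 0(4) by auto
next
  case (Suc l)
  let ?h = "c * Suc l"
  obtain j \<rho>1 M1 where 1: "j \<le> c" "reaches w' P (2 * T + R + 23) (10, \<rho>, table @ M)
      (if j < c then exit_addr R p else 10, \<rho>1, table @ M1)"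
    "regs_ok x \<rho>1" "\<rho>1 2 = num (?h - j, x div 4 ^ (?h - j))" "M1 \<in> \<M>" "(?h - j, x div 4 ^ (?h - j)) \<in> N"
    "j < c \<longrightarrow> (?h - Suc j, x div 4 ^ (?h - Suc j)) \<notin> N"
    using round_run[OF Suc.prems(1-3) _ Suc.prems(4)] by auto
  show ?case
  proof (cases "j < c")
    case True
    then have "(?h - j - 1, x div 4 ^ (?h - j - 1)) \<notin> N" using 1(7) by simp
    then obtain \<rho>' where 2: "reaches w' P 14 (exit_addr R p, \<rho>1, table @ M1)
        (exit_addr R p + 14, \<rho>', table @ M1)" "predecessor_answer S [x] (\<rho>' 0, \<rho>' 1)"
      using lookup_run[OF 1(3,4,6)] by metis
    have "reaches w' P (2 * T + R + 23 + 14) (10, \<rho>, table @ M) (exit_addr R p + 14, \<rho>', table @ M1)"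
      using reaches_trans[OF 1(2)[unfolded if_P[OF True]] 2(1)] .
    then have "reaches w' P (Suc l * (2 * T + R + 23) + 20) (10, \<rho>, table @ M)
        (exit_addr R p + 14, \<rho>', table @ M1)"
      by (rule reaches_mono) simp
    then show ?thesis using 2(2) 1(5) by blast
  next
    case False
    then have "j = c" "?h - j = c * l" using 1(1) by auto
    then obtain \<rho>' M' where 2: "reaches w' P (l * (2 * T + R + 23) + 20) (10, \<rho>1, table @ M1)
      (exit_addr R p + 14, \<rho>', table @ M')" "M' \<in> \<M>" "predecessor_answer S [x] (\<rho>' 0, \<rho>' 1)"
      using Suc.IH[OF 1(3) _ _ 1(5)] 1(4,6) by metis
    have "reaches w' P (2 * T + R + 23 + (l * (2 * T + R + 23) + 20)) (10, \<rho>, table @ M)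
      (exit_addr R p + 14, \<rho>', table @ M')"
      using reaches_trans[OF 1(2)[unfolded if_not_P[OF False]] 2(1)] .
    moreover have "2 * T + R + 23 + (l * (2 * T + R + 23) + 20) = Suc l * (2 * T + R + 23) + 20" by simp
    ultimately show ?thesis using 2(2,3) by metis
  qed
qed

text \<open>The admissible memories are those of the given structure behind the table, which no
  query changes. The search starts at the trie root since \<open>x < 4 ^ D\<close>; the 30 extra
  steps are 10 for the prelude and 20 around the rounds.\<close>

lemma supports_predecessor:
  assumes "\<M> \<noteq> {}" "\<And>M. M \<in> \<M> \<Longrightarrow> real (length M) \<le> sp" "U \<le> 4 ^ D"
  shows "supports_queries w' P {[x] | x. x < U} (predecessor_answer S)
    (sp + 5 + 6 * real m) (real (k * (2 * T + R + 23) + 30))"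
  unfolding supports_queries_def
proof (intro exI[of _ "(@) table ` \<M>"] conjI ballI)
  show "(@) table ` \<M> \<noteq> {}" using assms(1) by simp
next
  fix M assume "M \<in> (@) table ` \<M>"
  then obtain M0 where M: "M = table @ M0" "M0 \<in> \<M>" by blast
  show "real (length M) \<le> sp + 5 + 6 * real m" using assms(2)[OF M(2)] by (simp add: M(1) length_table)
  show "set M \<subseteq> {..<2 ^ w'}"
  proof -
    have "{..<2 ^ w} \<subseteq> {..<(2::nat) ^ w'}" using word_facts(1) by auto
    then have "set M0 \<subseteq> {..<2 ^ w'}" by (rule order_trans[OF words[OF M(2)]])
    then show ?thesis using table_words unfolding M(1) set_append by (rule Un_least[rotated])
  qed
  fix args assume "args \<in> {[x] | x. x < U}"
  then obtain x where x: "args = [x]" "x < U" by blast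
  obtain \<rho> where 1: "reaches w' P 10 (0, input_regs args, table @ M0) (10, \<rho>, table @ M0)"
    "regs_ok x \<rho>" "\<rho> 2 = num (D, 0)"
    using prelude_run[of "input_regs args" x] by (auto simp: input_regs_def x(1))
  have x0: "x div 4 ^ (c * k) = 0" using x(2) assms(3) by (simp add: D_eq)
  then obtain \<rho>' M' where 2: "reaches w' P (k * (2 * T + R + 23) + 20) (10, \<rho>, table @ M0)
      (exit_addr R p + 14, \<rho>', table @ M')" "M' \<in> \<M>" "predecessor_answer S [x] (\<rho>' 0, \<rho>' 1)"
    using loop_run[OF 1(2) _ _ M(2), of k] 1(3) root_in by (auto simp: D_eq)
  obtain t where t: "t \<le> 10 + (k * (2 * T + R + 23) + 20)"
    "halts_in w' P t (input_regs args) (table @ M0) \<rho>' (table @ M')"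
    using reaches_halts_in[OF reaches_trans[OF 1(1) 2(1)]] pred_program_code(11)[of R p]
    by (auto simp: code_at_Cons)
  then have "t \<le> k * (2 * T + R + 23) + 30" by simp
  then have "real t \<le> real (k * (2 * T + R + 23) + 30)" by (rule of_nat_mono)
  then show "\<exists>t r' M'. halts_in w' P t (input_regs args) M r' M' \<and>
      real t \<le> real (k * (2 * T + R + 23) + 30) \<and>
      M' \<in> (@) table ` \<M> \<and> predecessor_answer S args (r' 0, r' 1)"
    using t(2) 2(2,3) x(1) M(1) by blast
qed

end

section \<open>Sizes and asymptotics\<close>

lemma eventually_large_universeI:
  assumes "eventually (\<lambda>U. \<forall>n. P U n) at_top"
  shows "eventually (\<lambda>(U, n). P U n) large_universe"
  unfolding large_universe_def eventually_filtercomap using assms by force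

lemma bigo_add_linear:
  fixes s :: "nat \<Rightarrow> real"
  assumes "s \<in> \<Omega>(\<lambda>m. real m)"
  shows "(\<lambda>m. s m + 5 + 6 * real m) \<in> O(s)"
proof -
  have 1: "(\<lambda>m. real m) \<in> O(s)" using assms by (simp add: bigomega_iff_bigo)
  have "(\<lambda>m. 5 + 6 * real m) \<in> O(\<lambda>m. real m)" by real_asymp
  then have "(\<lambda>m. 5 + 6 * real m) \<in> O(s)" using 1 by (rule landau_o.big_trans)
  then show ?thesis by (simp add: add.assoc sum_in_bigo)
qed

lemma bigo_mult_floor:
  fixes q :: "nat \<Rightarrow> real" and a b :: nat
  assumes "q \<in> \<Omega>(\<lambda>m. 1)"
  shows "(\<lambda>m. real (a * (2 * nat \<lfloor>q m\<rfloor> + b) + 30)) \<in> O(q)"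
proof -
  have 1: "(\<lambda>m. 1) \<in> O(q)" using assms by (simp add: bigomega_iff_bigo)
  have "(\<lambda>m. real (a * b + 30)) \<in> O(\<lambda>m. 1 :: real)" by simp
  then have c: "(\<lambda>m. real (a * b + 30)) \<in> O(q)" using 1 by (rule landau_o.big_trans)
  have "(\<lambda>m. real (nat \<lfloor>q m\<rfloor>)) \<in> O(q)"
    by (intro landau_o.big_mono always_eventually allI) (simp, linarith)
  then have "(\<lambda>m. real (2 * a) * real (nat \<lfloor>q m\<rfloor>)) \<in> O(q)" by simp
  then have "(\<lambda>m. real (2 * a) * real (nat \<lfloor>q m\<rfloor>) + real (a * b + 30)) \<in> O(q)"
    using c by (rule sum_in_bigo)
  then show ?thesis by (simp add: algebra_simps)
qed

text \<open>
  With a constant number \<open>k\<close> of blocks and base 4, the \<open>c * k\<close> digits of a key are at most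
  \<open>log 2 U\<close> many once \<open>U\<close> is large, in spite of rounding; base 2 would exceed the available \<open>n log U\<close> nodes.
\<close>

definition block_length :: "nat \<Rightarrow> nat \<Rightarrow> nat" where
  "block_length k U = nat \<lfloor>log 4 (real U) / real k\<rfloor> + 1"

text \<open>The maximum makes room for the paths and the trie for every \<open>U\<close>, including
  small ones where \<open>reduction_size\<close> is too small. The summand 2 counts the root and the
  trie root.\<close>

definition tree_size :: "real \<Rightarrow> nat \<Rightarrow> nat \<Rightarrow> nat \<Rightarrow> nat" where
  "tree_size \<epsilon> k U n = (let c = block_length k U in
    max (2 + 4 ^ c * Suc c + n * (c * k)) (reduction_size \<epsilon> U n))"

lemma block_length_bounds:
  assumes "0 < k" "0 < U"
  shows "real (block_length k U) \<le> log 4 (real U) / real k + 1"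
    "log 4 (real U) / real k \<le> real (block_length k U)"
proof -
  have "0 \<le> log 4 (real U) / real k" using assms by simp
  then show "real (block_length k U) \<le> log 4 (real U) / real k + 1"
    "log 4 (real U) / real k \<le> real (block_length k U)"
    unfolding block_length_def by linarith+
qed

lemma le_power_block_length:
  assumes "0 < k"
  shows "U \<le> 4 ^ (block_length k U * k)"
proof (cases "U = 0")
  case False
  then have "log 4 (real U) \<le> real (block_length k U * k)"
    using block_length_bounds(2)[OF assms, of U] assms by (simp add: field_simps)
  then have "real U \<le> 4 powr real (block_length k U * k)"
    using False by (simp add: log_le_iff)
  also have "(4::real) powr real (block_length k U * k) = real (4 ^ (block_length k U * k))"
    by (subst powr_realpow) simp_all
  finally have "real U \<le> real (4 ^ (block_length k U * k))" .
  then show ?thesis by (simp only: of_nat_le_iff)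
qed simp

text \<open>The block paths are absorbed by \<open>2 * U powr \<epsilon>\<close>, since
  \<open>U powr (1 / k)\<close> times a logarithm grows more slowly. For the keys,
  \<open>c * k\<close> is at most half of \<open>log 2 U\<close> plus \<open>k\<close>; this
  comparison does not involve \<open>n\<close>, whence the uniformity.\<close>

lemma tree_size_eq:
  assumes "0 < \<epsilon>" "0 < k" "1 / real k < \<epsilon>"
  shows "\<forall>\<^sub>F U in at_top. \<forall>n. tree_size \<epsilon> k U n = reduction_size \<epsilon> U n"
proof -
  define \<delta> where "\<delta> = 1 / real k"
  have \<delta>: "0 < \<delta>" "\<delta> < \<epsilon>" using assms by (simp_all add: \<delta>_def)
  \<comment> \<open>From \<open>c \<le> \<delta> * log 4 U + 1\<close> come
    \<open>4 ^ c \<le> 4 * U powr \<delta>\<close> and the factor bounding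
    \<open>c + 1\<close>.\<close>
  have "\<forall>\<^sub>F x in at_top. 2 + 4 * x powr \<delta> * (log 4 x * \<delta> + 2) \<le> 2 * x powr \<epsilon>"
    using \<delta> by real_asymp
  then have "\<forall>\<^sub>F U in at_top. 2 + 4 * real U powr \<delta> * (log 4 (real U) * \<delta> + 2) \<le> 2 * real U powr \<epsilon>"
    by (rule eventually_compose_filterlim) (rule filterlim_real_sequentially)
  moreover have "\<forall>\<^sub>F U in at_top. 2 * real k \<le> log 2 (real U)" by real_asymp
  ultimately show ?thesis
    using eventually_gt_at_top[of 0]
  proof eventually_elim
    case (elim U)
    let ?c = "block_length k U"
    note c = block_length_bounds[OF assms(2) elim(3)]
    have l: "log 4 (real U) = log 2 (real U) / 2"
      using log_base_pow[of 2 2 "real U"] by simp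
    have D: "real (?c * k) \<le> log 2 (real U)"
      using c(1) assms(2) elim(2) unfolding l by (simp add: field_simps)
    have "(4::real) ^ ?c \<le> 4 powr (log 4 (real U) * \<delta> + 1)"
      using c(1) by (simp add: \<delta>_def flip: powr_realpow)
    also have "\<dots> = 4 * real U powr \<delta>"
      using elim(3) by (simp add: powr_add flip: powr_powr)
    finally have "(4::real) ^ ?c * (real ?c + 1) \<le> 4 * real U powr \<delta> * (log 4 (real U) * \<delta> + 2)"
      using c(1) by (intro mult_mono) (simp_all add: \<delta>_def)
    then have a: "2 + 4 ^ ?c * (real ?c + 1) \<le> 2 * real U powr \<epsilon>" using elim(1) by linarith
    have b: "real n * real (?c * k) \<le> real n * log 2 (real U)" for n
      using D by (rule mult_left_mono) simp
    have "real (2 + 4 ^ ?c * Suc ?c + n * (?c * k)) \<le> 2 * real U powr \<epsilon> + real n * log 2 (real U)" for n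
      using add_mono[OF a b[of n]] by (simp add: algebra_simps)
    then have "2 + 4 ^ ?c * Suc ?c + n * (?c * k) \<le> reduction_size \<epsilon> U n" for n
      unfolding reduction_size_def using order_trans[OF _ real_nat_ceiling_ge] of_nat_le_iff by blast
    then show ?case by (simp add: tree_size_def Let_def)
  qed
qed

text \<open>The summand \<open>2 * U powr \<epsilon>\<close> alone tends to infinity, so the number
  of keys cannot delay the threshold.\<close>

lemma reduction_size_at_top:
  assumes "0 < \<epsilon>" "\<forall>\<^sub>F m in at_top. Q m"
  shows "\<forall>\<^sub>F U in at_top. \<forall>n. Q (reduction_size \<epsilon> U n)"
proof -
  obtain M where M: "\<And>m. M \<le> m \<Longrightarrow> Q m" using assms(2) by (auto simp: eventually_at_top_linorder)
  have "\<forall>\<^sub>F U in at_top. real M \<le> 2 * real U powr \<epsilon>" using assms(1) by real_asymp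
  then show ?thesis
    using eventually_gt_at_top[of 0]
  proof eventually_elim
    case (elim U)
    have "real M \<le> real (reduction_size \<epsilon> U n)" for n
    proof -
      have "0 \<le> real n * log 2 (real U)" using elim(2) by simp
      then have "real M \<le> 2 * real U powr \<epsilon> + real n * log 2 (real U)" using elim(1) by linarith
      then show ?thesis unfolding reduction_size_def using real_nat_ceiling_ge order_trans by blast
    qed
    then show ?case using M by simp
  qed
qed

lemma tree_size_bigo:
  assumes "f \<in> O(g)" "0 < \<epsilon>" "0 < k" "1 / real k < \<epsilon>"
  shows "(\<lambda>(U, n). f (tree_size \<epsilon> k U n) :: real) \<in>
    O[large_universe](\<lambda>(U, n). g (reduction_size \<epsilon> U n) :: real)"
proof -
  obtain C where C: "0 < C" "\<forall>\<^sub>F m in at_top. norm (f m) \<le> C * norm (g m)" using assms(1) by (rule landau_o.bigE)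
  have "\<forall>\<^sub>F U in at_top. \<forall>n. norm (f (tree_size \<epsilon> k U n)) \<le> C * norm (g (reduction_size \<epsilon> U n))"
    using tree_size_eq[OF assms(2-4)] reduction_size_at_top[OF assms(2) C(2)]
    by eventually_elim simp
  from eventually_large_universeI[OF this] show ?thesis
    by (intro landau_o.bigI[OF C(1)]) (simp add: case_prod_unfold)
qed

text \<open>The maximum over all possible numbers of keys removes the dependence on
  \<open>n\<close>, without assuming \<open>W\<close> monotone. The second summand accommodates
  \<open>4 ^ D\<close>, and 10 spare bits accommodate the table next to \<open>2 ^ w\<close>
  simulated words.\<close>

definition word_size :: "(nat \<Rightarrow> nat) \<Rightarrow> real \<Rightarrow> nat \<Rightarrow> nat \<Rightarrow> nat" where
  "word_size W \<epsilon> k U = Max ((\<lambda>n. W (tree_size \<epsilon> k U n)) ` {..U}) + 2 * (block_length k U * k) + 10"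

text \<open>The digits alone give the lower bound. For the upper bound, at most \<open>U\<close>
  keys give a tree of polynomial size in \<open>U\<close>, so its word size is
  \<open>O(log U)\<close>.\<close>

lemma word_size_logarithmic:
  assumes W: "logarithmic_word_size W" and "0 < \<epsilon>" "0 < k" "1 / real k < \<epsilon>"
  shows "logarithmic_word_size (word_size W \<epsilon> k)"
  unfolding logarithmic_word_size_def
proof (intro conjI allI bigthetaI)
  fix U
  have "U \<le> 4 ^ (block_length k U * k)" by (rule le_power_block_length[OF assms(3)])
  also have "\<dots> = 2 ^ (2 * (block_length k U * k))" by (simp add: power_mult)
  also have "\<dots> \<le> 2 ^ word_size W \<epsilon> k U" by (rule power_increasing) (simp_all add: word_size_def)
  finally show "U \<le> 2 ^ word_size W \<epsilon> k U" .
next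
  have "\<forall>\<^sub>F U in at_top. norm (log 2 (real U)) \<le> 1 * norm (real (word_size W \<epsilon> k U))"
    using eventually_gt_at_top[of 0]
  proof eventually_elim
    case (elim U)
    have "log 4 (real U) = log 2 (real U) / 2"
      using log_base_pow[of 2 2 "real U"] by simp
    then have "log 2 (real U) \<le> real (2 * (block_length k U * k))"
      using block_length_bounds(2)[OF assms(3) elim] assms(3) by (simp add: field_simps)
    also have "\<dots> \<le> real (word_size W \<epsilon> k U)" unfolding word_size_def of_nat_le_iff by simp
    finally show ?case using elim by simp
  qed
  then show "(\<lambda>N. real (word_size W \<epsilon> k N)) \<in> \<Omega>(\<lambda>N. log 2 (real N))"
    unfolding bigomega_iff_bigo by (rule landau_o.bigI[rotated]) simp
next
  have "(\<lambda>N. real (W N)) \<in> O(\<lambda>N. log 2 (real N))"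
    using W by (simp add: logarithmic_word_size_def bigthetaD1)
  then obtain C where C: "0 < C" "\<forall>\<^sub>F m in at_top. norm (real (W m)) \<le> C * norm (log 2 (real m))"
    by (rule landau_o.bigE)
  have "\<forall>\<^sub>F m in at_top. real (W m) \<le> C * log 2 (real m) \<and> 1 < m"
    using C(2) eventually_gt_at_top[of 1] by eventually_elim auto
  note ev = reduction_size_at_top[OF assms(2) this]
  \<comment> \<open>The exponent is generous: each of the two intermediate estimates uses up half of
    the right-hand side.\<close>
  have big: "\<forall>\<^sub>F U in at_top. 2 * real U powr \<epsilon> + real U * log 2 (real U) + 1 \<le> real U powr (\<epsilon> + 3)"
  proof -
    have "\<forall>\<^sub>F U in at_top. 4 * real U powr \<epsilon> \<le> real U powr (\<epsilon> + 3)" by real_asymp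
    moreover have "\<forall>\<^sub>F U in at_top. 2 * (real U * log 2 (real U)) + 2 \<le> real U powr 3" by real_asymp
    ultimately show ?thesis
      using eventually_gt_at_top[of 0]
    proof eventually_elim
      case (elim U)
      have "real U powr 3 \<le> real U powr (\<epsilon> + 3)" using elim(3) assms(2) by (intro powr_mono) auto
      then show ?case using elim(1,2) by linarith
    qed
  qed
  have "\<forall>\<^sub>F U in at_top. 2 * real k \<le> log 2 (real U)" by real_asymp
  \<comment> \<open>Of the constant 12, the digits use 2, and the 10 spare bits use 10 because
    \<open>log 2 U \<ge> 1\<close>.\<close>
  then have "\<forall>\<^sub>F U in at_top. norm (real (word_size W \<epsilon> k U)) \<le> (C * (\<epsilon> + 3) + 12) * norm (log 2 (real U))"
    using tree_size_eq[OF assms(2-4)] ev big eventually_gt_at_top[of 1]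
  proof eventually_elim
    case (elim U)
    have W_le: "real (W (tree_size \<epsilon> k U n)) \<le> C * (\<epsilon> + 3) * log 2 (real U)" if n: "n \<le> U" for n
    proof -
      let ?m = "reduction_size \<epsilon> U n"
      have l0: "0 \<le> log 2 (real U)" using elim(5) by simp
      then have "real n * log 2 (real U) \<le> real U * log 2 (real U)" using n by (intro mult_right_mono) simp_all
      moreover have "real ?m \<le> 2 * real U powr \<epsilon> + real n * log 2 (real U) + 1"
      proof -
        have "0 \<le> 2 * real U powr \<epsilon> + real n * log 2 (real U)" using l0 by simp
        then show ?thesis unfolding reduction_size_def by linarith
      qed
      ultimately have "real ?m \<le> real U powr (\<epsilon> + 3)" using elim(4) by linarith
      then have "log 2 (real ?m) \<le> log 2 (real U powr (\<epsilon> + 3))"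
        using less_trans[OF zero_less_one conjunct2[OF spec[OF elim(3)]]] by (intro log_mono) simp_all
      also have "\<dots> = (\<epsilon> + 3) * log 2 (real U)" using elim(5) by (simp add: log_powr)
      finally have "C * log 2 (real ?m) \<le> C * ((\<epsilon> + 3) * log 2 (real U))"
        using C(1) by simp
      then show ?thesis
        using order_trans[OF conjunct1[OF spec[OF elim(3), of n]]] elim(2) by (simp add: mult.assoc)
    qed
    have "Max ((\<lambda>n. W (tree_size \<epsilon> k U n)) ` {..U}) \<in> (\<lambda>n. W (tree_size \<epsilon> k U n)) ` {..U}"
      by (rule Max_in) auto
    then obtain n where "Max ((\<lambda>n. W (tree_size \<epsilon> k U n)) ` {..U}) = W (tree_size \<epsilon> k U n)" "n \<in> {..U}"
      by (rule imageE)
    then have M: "real (Max ((\<lambda>n. W (tree_size \<epsilon> k U n)) ` {..U})) \<le> C * (\<epsilon> + 3) * log 2 (real U)"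
      using W_le[of n] by (simp only: atMost_iff)
    have "log 4 (real U) = log 2 (real U) / 2"
      using log_base_pow[of 2 2 "real U"] by simp
    then have "real (block_length k U * k) \<le> log 2 (real U)"
      using block_length_bounds(1)[OF assms(3), of U] elim(1,5) assms(3) by (simp add: field_simps)
    moreover have "1 \<le> log 2 (real U)" using elim(5) by (simp add: le_log_iff)
    ultimately have "real (word_size W \<epsilon> k U) \<le> C * (\<epsilon> + 3) * log 2 (real U) + 12 * log 2 (real U)"
      using M unfolding word_size_def by simp
    then show ?case using elim(5) by (simp add: algebra_simps)
  qed
  moreover have "0 < C * (\<epsilon> + 3) + 12"
    using C(1) assms(2) by (intro add_pos_pos mult_pos_pos) simp_all
  ultimately show "(\<lambda>N. real (word_size W \<epsilon> k N)) \<in> O(\<lambda>N. log 2 (real N))"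
    by (rule landau_o.bigI[rotated])
qed

lemma predecessor_from_lce:
  fixes s q :: "nat \<Rightarrow> real" and \<epsilon> :: real
  assumes lce: "\<And>m rt E lab. rooted_tree m rt E \<Longrightarrow> \<forall>e\<in>E. lab e < 2 ^ W m \<Longrightarrow>
      supports_queries (W m) p (lce_pt_queries m E) (lce_pt_answer E lab) (s m) (q m)"
    and W: "\<And>N. N \<le> 2 ^ W N"
    and R: "3 \<le> R" "\<And>i. i \<in> set p \<Longrightarrow> instr_regs i \<subseteq> {..<R}"
    and k: "0 < k" and S: "S \<subseteq> {..<U}"
  defines "m \<equiv> tree_size \<epsilon> k U (card S)"
  shows "supports_queries (word_size W \<epsilon> k U) (pred_program R p) {[x] | x. x < U} (predecessor_answer S)
    (s m + 5 + 6 * real m) (real (k * (2 * nat \<lfloor>q m\<rfloor> + (R + 23)) + 30))"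
proof -
  define c where "c = block_length k U"
  define D where "D = c * k"
  have fin: "finite S" using S finite_subset by blast
  have U: "U \<le> 4 ^ D" using le_power_block_length[OF k] by (simp add: D_def c_def)
  then have SD: "S \<subseteq> {..<4 ^ D}" using S by auto
  have cpos: "0 < c" by (simp add: c_def block_length_def)
  have m_ge: "2 + 4 ^ c * Suc c + card S * D \<le> m"
    by (simp add: m_def tree_size_def Let_def c_def D_def)
  note card = card_trie_nodes[OF fin SD]
  obtain f where f: "bij_betw f (trie_nodes S D) {0..<card (trie_nodes S D)}"
    using ex_bij_betw_finite_nat[OF card(1)] by blast
  \<comment> \<open>Any enumeration of the trie nodes will do; it is shifted past the root and the
    block paths.\<close>
  define num where "num u = f u + Suc (4 ^ c * Suc c)" for u
  interpret trie_tree S c D m num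
  proof
    show "inj_on num (trie_nodes S D)"
      using bij_betw_imp_inj_on[OF f] by (auto simp: inj_on_def num_def)
    have "f u < card (trie_nodes S D)" if "u \<in> trie_nodes S D" for u
      using bij_betwE[OF f] that by auto
    then show "num ` trie_nodes S D \<subseteq> {Suc (4 ^ c * Suc c)..<m}"
      using card(2) m_ge by (fastforce simp: num_def)
  qed (use fin SD in auto)
  define w where "w = W m"
  have mw: "m \<le> 2 ^ w" unfolding w_def by (rule W)
  \<comment> \<open>At least four nodes force words large enough for the labels 0 to 3.\<close>
  have "4 ^ 1 \<le> (4::nat) ^ c" using cpos by (intro power_increasing) auto
  then have "4 \<le> (4::nat) ^ c * Suc c" by (simp add: trans_le_add1)
  then have "4 \<le> m" using m_ge by linarith
  then have w4: "4 \<le> (2::nat) ^ w" using mw by linarith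
  have "\<forall>e\<in>E. label e < 2 ^ w" using label_lt w4 order_less_le_trans by blast
  then have "supports_queries w p (lce_pt_queries m E) (lce_pt_answer E label) (s m) (q m)"
    unfolding w_def by (rule lce[OF rooted])
  then obtain \<M> where ne: "\<M> \<noteq> {}" and mem: "\<forall>M\<in>\<M>. real (length M) \<le> s m \<and> set M \<subseteq> {..<2 ^ w} \<and>
      (\<forall>args\<in>lce_pt_queries m E. \<exists>t r' M'. halts_in w p t (input_regs args) M r' M' \<and> real t \<le> q m \<and>
        M' \<in> \<M> \<and> lce_pt_answer E label args (r' 0, r' 1))"
    unfolding supports_queries_def by (elim exE conjE)
  have len: "real (length M) \<le> s m" and words: "set M \<subseteq> {..<2 ^ w}" if "M \<in> \<M>" for M
    using bspec[OF mem that] by simp_all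
  define w' where "w' = word_size W \<epsilon> k U"
  have "card S \<le> U" using card_mono[OF _ S] by simp
  then have "w \<le> Max ((\<lambda>n. W (tree_size \<epsilon> k U n)) ` {..U})"
    unfolding w_def m_def by (intro Max_ge) auto
  then have w'_ge: "w + 2 * D + 10 \<le> w'" by (simp add: w'_def word_size_def D_def c_def)
  have "(2::nat) ^ (w + 10) \<le> 2 ^ w'" "(2::nat) ^ (2 * D + 1) \<le> 2 ^ w'"
    using w'_ge by (intro power_increasing; simp)+
  then have w'_big: "2 ^ w * 1024 \<le> (2::nat) ^ w'" "4 ^ D * 2 \<le> (2::nat) ^ w'"
    by (simp_all add: power_add power_mult)
  interpret reduction S c D m num w w' k R "nat \<lfloor>q m\<rfloor>" p \<M>
  proof
    show "0 < w" using w4 by (cases w) auto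
    have "5 + 6 * m \<le> 11 * 2 ^ w" using mw w4 by linarith
    then show "2 ^ w + 5 + 6 * m < 2 ^ w'" using w'_big(1) w4 by linarith
    have "0 < (4::nat) ^ D" by simp
    then show "4 ^ D < (2::nat) ^ w'" using w'_big(2) by linarith
    fix M args assume "M \<in> \<M>" "args \<in> lce_pt_queries m E"
    then obtain t r' M' where "halts_in w p t (input_regs args) M r' M'" "real t \<le> q m" "M' \<in> \<M>"
      "lce_pt_answer E label args (r' 0, r' 1)"
      using mem by blast
    then show "\<exists>t r' M'. halts_in w p t (input_regs args) M r' M' \<and>
      t \<le> nat \<lfloor>q m\<rfloor> \<and> M' \<in> \<M> \<and> lce_pt_answer E label args (r' 0, r' 1)"
      using le_nat_floor by blast
  qed (use cpos D_def mw R words in blast)+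
  show ?thesis
    using supports_predecessor[OF ne len U] by (simp add: w'_def add.assoc)
qed

theorem theorem3:
  fixes \<epsilon> :: real and s q :: "nat \<Rightarrow> real"
  assumes "\<epsilon> > 0"
    and "s \<in> \<Omega>(\<lambda>m. real m)"
    and "q \<in> \<Omega>(\<lambda>m. 1)"
    and "lce_pt_structure s q"
  shows "\<exists>space time. predecessor_structure space time \<and>
    (\<lambda>(U, n). space U n) \<in> O[large_universe](\<lambda>(U, n). s (reduction_size \<epsilon> U n)) \<and>
    (\<lambda>(U, n). time U n) \<in> O[large_universe](\<lambda>(U, n). q (reduction_size \<epsilon> U n))"
proof -
  obtain W p where W: "logarithmic_word_size W"
    and lce: "\<And>m rt E lab. rooted_tree m rt E \<Longrightarrow> \<forall>e\<in>E. lab e < 2 ^ W m \<Longrightarrow>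
      supports_queries (W m) p (lce_pt_queries m E) (lce_pt_answer E lab) (s m) (q m)"
    using assms(4) unfolding lce_pt_structure_def by blast
  obtain R where R: "3 \<le> R" "\<And>i. i \<in> set p \<Longrightarrow> instr_regs i \<subseteq> {..<R}"
    using program_regs_bounded by blast
  obtain k where k: "0 < k" "1 / real k < \<epsilon>"
    using ex_inverse_of_nat_less[OF assms(1)] by (auto simp: inverse_eq_divide)
  define space where "space U n = (\<lambda>m. s m + 5 + 6 * real m) (tree_size \<epsilon> k U n)" for U n
  define time where
    "time U n = (\<lambda>m. real (k * (2 * nat \<lfloor>q m\<rfloor> + (R + 23)) + 30)) (tree_size \<epsilon> k U n)" for U n
  have fits: "N \<le> 2 ^ W N" for N using W by (simp add: logarithmic_word_size_def)
  have "supports_queries (word_size W \<epsilon> k U) (pred_program R p) {[x] | x. x < U} (predecessor_answer S)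
      (space U (card S)) (time U (card S))" if "S \<subseteq> {..<U}" for U S
    unfolding space_def time_def by (rule predecessor_from_lce[OF lce fits R k(1) that])
  then have "predecessor_structure space time"
    unfolding predecessor_structure_def using word_size_logarithmic[OF W assms(1) k] by blast
  moreover have "(\<lambda>(U, n). space U n) \<in> O[large_universe](\<lambda>(U, n). s (reduction_size \<epsilon> U n))"
    unfolding space_def by (rule tree_size_bigo[OF bigo_add_linear[OF assms(2)] assms(1) k])
  moreover have "(\<lambda>(U, n). time U n) \<in> O[large_universe](\<lambda>(U, n). q (reduction_size \<epsilon> U n))"
    unfolding time_def by (rule tree_size_bigo[OF bigo_mult_floor[OF assms(3)] assms(1) k])
  ultimately show ?thesis by blast
qed

end
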